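(* Let $N=\mathrm{SL}(2,\mathbb R)\times\mathrm{SL}(2,\mathbb R)$ with its pseudo-nearly Kähler structure $(g,J)$. A map $F:N\to N$ is an isometry of the pseudo-nearly Kähler manifold $N$ if and only if $F=\Psi\circ\phi$, where $\phi(p,q)=(apc^{-1},bqc^{-1})$ for some $a,b,c\in\mathrm{SL}^{\pm}(2,\mathbb R)$ with $\det a=\det b=\det c$, and $\Psi$ is one of the six maps $\Psi_{0,0}(p,q)=(p,q)$, $\Psi_{1,0}(p,q)=(q,p)$, $\Psi_{0,2\pi/3}(p,q)=(pq^{-1},q^{-1})$, $\Psi_{1,2\pi/3}(p,q)=(q^{-1},pq^{-1})$, $\Psi_{0,4\pi/3}(p,q)=(qp^{-1},p^{-1})$, $\Psi_{1,4\pi/3}(p,q)=(p^{-1},qp^{-1})$. Equivalently, the group $\big(\mathrm{SL}(2,\mathbb R)\times\mathrm{SL}(2,\mathbb R)\times\mathrm{SL}(2,\mathbb R)\big)\rtimes(\mathbb Z_2\times S_3)$, where $S_3=\{\Psi_{\kappa,\tau}\}$ (the symmetric group of order $6$, generated by $\Psi_{1,0}$ and $\Psi_{1,4\pi/3}$) and $\mathbb Z_2=\{0,1\}$, acting by $(a,b,c,\Psi,k)\cdot(p,q)=\Psi\big(\mathbf i^k a p c^{-1}\mathbf i^{-k},\ \mathbf i^k b q c^{-1}\mathbf i^{-k}\big)$, acts on $N$ by isometries of the pseudo-nearly Kähler structure and every such isometry arises in this way.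
   Context: Let $\langle a,b\rangle=-\tfrac12\operatorname{tr}(\operatorname{adj}(a)\,b)$ on $M(2,\mathbb R)$ (for traceless $\alpha,\beta$ this is $\tfrac12\operatorname{tr}(\alpha\beta)$). $\mathfrak{sl}(2,\mathbb R)$ is the space of traceless real $2\times2$ matrices, $\mathrm{SL}^{\pm}(2,\mathbb R)$ the group of real $2\times 2$ matrices of determinant $\pm1$, and the tangent space of $\mathrm{SL}(2,\mathbb R)$ at $a$ is $\{a\alpha:\alpha\in\mathfrak{sl}(2,\mathbb R)\}$. Let $\mathbf i=\begin{pmatrix}1&0\\0&-1\end{pmatrix}$, $\mathbf j=\begin{pmatrix}0&1\\1&0\end{pmatrix}$, $\mathbf k=\begin{pmatrix}0&1\\-1&0\end{pmatrix}$. On $N=\mathrm{SL}(2,\mathbb R)\times\mathrm{SL}(2,\mathbb R)$ define, for $\alpha,\beta,\gamma,\delta\in\mathfrak{sl}(2,\mathbb R)$: the metric $g((a\alpha,b\beta),(a\gamma,b\delta))=\tfrac23(\langle\alpha,\gamma\rangle+\langle\beta,\delta\rangle)-\tfrac13(\langle\beta,\gamma\rangle+\langle\alpha,\delta\rangle)$; the almost complex structure $J(a\alpha,b\beta)=\tfrac1{\sqrt3}\big(a(\alpha-2\beta),\,b(2\alpha-\beta)\big)$. $(N,g,J)$ is a pseudo-nearly Kähler manifold. An isometry of the pseudo-nearly Kähler manifold $N$ is a diffeomorphism $F$ with $F^*g=g$ and $dF\circ J=\pm J\circ dF$. *)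

theory Defs
  imports "HOL-Analysis.Analysis"
begin

type_synonym mat2 = "real^2^2"
type_synonym pt = "mat2 \<times> mat2"

definition dirderiv :: "'a::real_normed_vector \<Rightarrow> ('a \<Rightarrow> 'b::real_normed_vector) \<Rightarrow> 'a \<Rightarrow> 'b" where
  "dirderiv v g = (\<lambda>x. frechet_derivative g (at x) v)"

definition smooth_on :: "'a::real_normed_vector set \<Rightarrow> ('a \<Rightarrow> 'b::real_normed_vector) \<Rightarrow> bool" where
  "smooth_on U f \<longleftrightarrow> open U \<and> (\<forall>vs. \<forall>x\<in>U. foldr dirderiv vs f differentiable (at x))"

definition smooth_ext :: "'a::real_normed_vector set \<Rightarrow> ('a \<Rightarrow> 'b::real_normed_vector) \<Rightarrow> ('a \<Rightarrow> 'b) \<Rightarrow> bool" where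
  "smooth_ext S F G \<longleftrightarrow> (\<exists>U. smooth_on U G \<and> S \<subseteq> U) \<and> (\<forall>x\<in>S. G x = F x)"

definition SL2 :: "mat2 set" where "SL2 = {a. det a = 1}"

definition NN :: "pt set" where "NN = SL2 \<times> SL2"

definition adj2 :: "mat2 \<Rightarrow> mat2" where
  "adj2 A = vector [vector [A$2$2, - A$1$2], vector [- A$2$1, A$1$1]]"

definition br :: "mat2 \<Rightarrow> mat2 \<Rightarrow> real" where
  "br a b = - (1/2) * trace (adj2 a ** b)"

definition tangent :: "pt \<Rightarrow> pt set" where
  "tangent p = {(fst p ** \<alpha>, snd p ** \<beta>) | \<alpha> \<beta>. trace \<alpha> = 0 \<and> trace \<beta> = 0}"

definition gN :: "pt \<Rightarrow> pt \<Rightarrow> pt \<Rightarrow> real" where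
  "gN p v w = (let \<alpha> = matrix_inv (fst p) ** fst v; \<beta> = matrix_inv (snd p) ** snd v;
                   \<gamma> = matrix_inv (fst p) ** fst w; \<delta> = matrix_inv (snd p) ** snd w
               in (2/3) * (br \<alpha> \<gamma> + br \<beta> \<delta>) - (1/3) * (br \<beta> \<gamma> + br \<alpha> \<delta>))"

definition JN :: "pt \<Rightarrow> pt \<Rightarrow> pt" where
  "JN p v = (let \<alpha> = matrix_inv (fst p) ** fst v; \<beta> = matrix_inv (snd p) ** snd v
             in (1 / sqrt 3) *\<^sub>R (fst p ** (\<alpha> - 2 *\<^sub>R \<beta>), snd p ** (2 *\<^sub>R \<alpha> - \<beta>)))"

text \<open>Isometry of the pseudo-nearly Kaehler manifold N: a diffeomorphism of N preserving g,
  with dF o J = J o dF or dF o J = - J o dF. The differential dF at p is the Frechet derivative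
  of any smooth extension G of F to an open neighbourhood of N (independent of the extension on
  tangent vectors).\<close>
definition isometry_NK :: "(pt \<Rightarrow> pt) \<Rightarrow> bool" where
  "isometry_NK F \<longleftrightarrow>
     F ` NN = NN \<and> inj_on F NN \<and> (\<exists>H. smooth_ext NN (inv_into NN F) H) \<and>
     (\<exists>G. smooth_ext NN F G \<and>
        (\<forall>p\<in>NN. \<forall>v\<in>tangent p. \<forall>w\<in>tangent p.
            gN (F p) (frechet_derivative G (at p) v) (frechet_derivative G (at p) w) = gN p v w) \<and>
        (\<exists>\<epsilon>::real. (\<epsilon> = 1 \<or> \<epsilon> = -1) \<and>
            (\<forall>p\<in>NN. \<forall>v\<in>tangent p.
               frechet_derivative G (at p) (JN p v) = \<epsilon> *\<^sub>R JN (F p) (frechet_derivative G (at p) v))))"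

definition phi :: "mat2 \<Rightarrow> mat2 \<Rightarrow> mat2 \<Rightarrow> pt \<Rightarrow> pt" where
  "phi a b c x = (a ** fst x ** matrix_inv c, b ** snd x ** matrix_inv c)"

definition Psi_set :: "(pt \<Rightarrow> pt) set" where
  "Psi_set = {
     (\<lambda>(p,q). (p, q)),
     (\<lambda>(p,q). (q, p)),
     (\<lambda>(p,q). (p ** matrix_inv q, matrix_inv q)),
     (\<lambda>(p,q). (matrix_inv q, p ** matrix_inv q)),
     (\<lambda>(p,q). (q ** matrix_inv p, matrix_inv p)),
     (\<lambda>(p,q). (matrix_inv p, q ** matrix_inv p))}"

end

theory Submission
  imports Defs
begin

text \<open>In the left trivialisation the differential of an isometry is a family \<open>L\<close> of linear maps of
  \<open>sl(2) \<oplus> sl(2)\<close> that preserve the metric and, up to sign, the complex structure.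
  N is the 3-symmetric space \<open>G^3 / \<Delta> G\<close>, and its canonical Hermitian connection has a torsion that is
  totally skew and complex antilinear. Pulling back the Maurer--Cartan form and running the Koszul argument
  shows that \<open>L\<close> is parallel for this connection and preserves its torsion; differentiating once more, \<open>L\<close>
  preserves its curvature, whose image is the diagonal \<open>ad sl(2)\<close>. So at the base point \<open>L\<close>
  normalises \<open>ad sl(2)\<close>: it is conjugation by some \<open>c\<close> of determinant \<open>\<plusminus>1\<close> followed by a real \<open>2 \<times> 2\<close>
  matrix, and torsion invariance leaves six such matrices, those of the permutations of the three factors
  of \<open>G^3\<close>. Hence some model map agrees with the isometry to first order at the base point. The
  parallelism of \<open>L\<close> is an ordinary differential equation along curves, the same for both
  maps, so they agree everywhere.\<close>

section \<open>Iterated directional derivatives\<close>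

text \<open>The isometry lives on N only, and an extension \<open>G\<close> obeys the metric and
  complex equations merely at points of N, so every identity may be differentiated only along N.
  Pairs of nilpotent matrices make this elementary: \<open>1 + t n\<close> has determinant 1, hence
  straight lines in these directions stay in N, and the directions span each tangent space. The same
  lines replace the exponential map when N is reached from the base point. The constants come from
  lifting (\<alpha>, \<beta>) to (\<alpha>, \<beta>, 0) in three copies of sl(2) and splitting off
  the mean (\<alpha> + \<beta>) / 3, which is \<open>mu\<close>. On the mean-free part the metric is
  the sum of three copies of \<open>br\<close>, and J is (2 s + 1) / sqrt 3 with s a cyclic rotation
  of the factors. Permutations of the factors are therefore isometric; even ones commute with s and
  with J, odd ones invert s and change the sign of J.\<close>

fun diff_times :: "nat \<Rightarrow> 'a::real_normed_vector set \<Rightarrow> ('a \<Rightarrow> 'b::real_normed_vector) \<Rightarrow> bool" where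
  "diff_times 0 U f \<longleftrightarrow> (\<forall>x\<in>U. f differentiable at x)"
| "diff_times (Suc n) U f \<longleftrightarrow> (\<forall>x\<in>U. f differentiable at x) \<and> (\<forall>v. diff_times n U (dirderiv v f))"

lemma diff_times_differentiable: "diff_times n U f \<Longrightarrow> x \<in> U \<Longrightarrow> f differentiable at x"
  by (cases n) auto

lemma diff_times_dirderiv: "diff_times (Suc n) U f \<Longrightarrow> diff_times n U (dirderiv v f)"
  by simp

lemma diff_times_pred: "diff_times (Suc n) U f \<Longrightarrow> diff_times n U f"
  by (induction n arbitrary: f) auto

text \<open>The index is off by one: \<open>diff_times n\<close> tests differentiability after at
  most n directional derivatives, so it grants n + 1 of them. The induction strips the innermost
  direction, the last entry of the list under \<open>foldr\<close>.\<close>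

lemma smooth_on_imp_diff_times:
  assumes "smooth_on U f" shows "diff_times n U f"
proof -
  have "\<forall>vs. \<forall>x\<in>U. foldr dirderiv vs f differentiable (at x) \<Longrightarrow> diff_times n U f"
  proof (induction n arbitrary: f)
    case 0
    show ?case using 0[rule_format, of _ "[]"] by simp
  next
    case (Suc n)
    have "\<forall>vs. \<forall>x\<in>U. foldr dirderiv vs (dirderiv v f) differentiable (at x)" for v
    proof (intro allI)
      fix vs
      show "\<forall>x\<in>U. foldr dirderiv vs (dirderiv v f) differentiable (at x)"
        using Suc.prems[rule_format, of _ "vs @ [v]"] by simp
    qed
    then show ?case using Suc.IH Suc.prems[rule_format, of _ "[]"] by simp
  qed
  then show ?thesis using assms by (simp add: smooth_on_def)
qed

lemma dirderiv_eqI: "(f has_derivative f') (at x) \<Longrightarrow> dirderiv v f x = f' v"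
  by (simp add: dirderiv_def frechet_derivative_at[symmetric])

lemma has_derivative_dirderiv:
  assumes "f differentiable at x"
  shows "(f has_derivative (\<lambda>v. dirderiv v f x)) (at x)"
  using assms unfolding dirderiv_def frechet_derivative_works by simp

lemma linear_dirderiv:
  assumes "f differentiable at x"
  shows "linear (\<lambda>v. dirderiv v f x)"
  using has_derivative_dirderiv[OF assms] has_derivative_linear by blast

lemma dirderiv_cong_open:
  assumes "open U" "\<And>x. x \<in> U \<Longrightarrow> f x = g x" "x \<in> U" "f differentiable at x"
  shows "g differentiable at x" "dirderiv v f x = dirderiv v g x"
proof -
  have d: "(g has_derivative (\<lambda>v. dirderiv v f x)) (at x)"
    using has_derivative_transform_within_open[OF has_derivative_dirderiv[OF assms(4)] assms(1,3)] assms(2)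
    by simp
  then show "g differentiable at x" by (auto simp: differentiable_def)
  show "dirderiv v f x = dirderiv v g x" using dirderiv_eqI[OF d] by simp
qed

text \<open>Outside U a function may fail to be differentiable and \<open>frechet_derivative\<close>
  is then an arbitrary choice, so sum and product rules hold on U only. The closure rules below pass
  through this transfer.\<close>

lemma diff_times_cong:
  assumes "open U" "\<And>x. x \<in> U \<Longrightarrow> f x = g x" "diff_times n U f"
  shows "diff_times n U g"
  using assms(2,3)
proof (induction n arbitrary: f g)
  case 0
  then show ?case using dirderiv_cong_open(1)[OF assms(1), of f g] by simp
next
  case (Suc n)
  have "diff_times n U (dirderiv v g)" for v
    by (rule Suc.IH[of "dirderiv v f"])
       (use Suc.prems dirderiv_cong_open(2)[OF assms(1), of f g] in auto)
  then show ?case using Suc.prems dirderiv_cong_open(1)[OF assms(1), of f g] by auto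
qed

lemma dirderiv_add:
  assumes "f differentiable at x" "g differentiable at x"
  shows "dirderiv v (\<lambda>x. f x + g x) x = dirderiv v f x + dirderiv v g x"
  by (rule dirderiv_eqI[OF has_derivative_add[OF assms[THEN has_derivative_dirderiv]]])

lemma dirderiv_linear_compose:
  assumes "bounded_linear T" "f differentiable at x"
  shows "dirderiv v (\<lambda>x. T (f x)) x = T (dirderiv v f x)"
  by (rule dirderiv_eqI[OF bounded_linear.has_derivative[OF assms(1) assms(2)[THEN has_derivative_dirderiv]]])

lemma dirderiv_bilinear:
  assumes "bounded_bilinear b" "f differentiable at x" "g differentiable at x"
  shows "dirderiv v (\<lambda>x. b (f x) (g x)) x = b (f x) (dirderiv v g x) + b (dirderiv v f x) (g x)"
  by (rule dirderiv_eqI[OF bounded_bilinear.FDERIV[OF assms(1) assms(2,3)[THEN has_derivative_dirderiv]]])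

lemma differentiable_linear_compose:
  "bounded_linear T \<Longrightarrow> f differentiable at x \<Longrightarrow> (\<lambda>x. T (f x)) differentiable at x"
  unfolding differentiable_def using bounded_linear.has_derivative by blast

lemma differentiable_bilinear:
  "bounded_bilinear b \<Longrightarrow> f differentiable at x \<Longrightarrow> g differentiable at x \<Longrightarrow> (\<lambda>x. b (f x) (g x)) differentiable at x"
  unfolding differentiable_def using bounded_bilinear.FDERIV by blast

lemma diff_times_add:
  assumes "open U" "diff_times n U f" "diff_times n U g"
  shows "diff_times n U (\<lambda>x. f x + g x)"
  using assms(2,3)
proof (induction n arbitrary: f g)
  case (Suc n)
  have "diff_times n U (dirderiv v (\<lambda>x. f x + g x))" for v
    by (rule diff_times_cong[OF assms(1) _ Suc.IH[of "dirderiv v f" "dirderiv v g"]])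
       (use Suc.prems in \<open>auto simp: dirderiv_add\<close>)
  then show ?case using Suc.prems by (auto intro!: derivative_intros)
qed (auto intro!: derivative_intros)

lemma diff_times_linear:
  assumes "open U" "bounded_linear T" "diff_times n U f"
  shows "diff_times n U (\<lambda>x. T (f x))"
  using assms(3)
proof (induction n arbitrary: f)
  case (Suc n)
  have "diff_times n U (dirderiv v (\<lambda>x. T (f x)))" for v
    by (rule diff_times_cong[OF assms(1) _ Suc.IH[of "dirderiv v f"]])
       (use Suc.prems in \<open>auto simp: dirderiv_linear_compose[OF assms(2)]\<close>)
  then show ?case using Suc.prems by (auto intro!: differentiable_linear_compose[OF assms(2)])
qed (auto intro!: differentiable_linear_compose[OF assms(2)])

lemma diff_times_bilinear:
  assumes "open U" "bounded_bilinear b" "diff_times n U f" "diff_times n U g"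
  shows "diff_times n U (\<lambda>x. b (f x) (g x))"
  using assms(3,4)
proof (induction n arbitrary: f g)
  case (Suc n)
  have "diff_times n U (dirderiv v (\<lambda>x. b (f x) (g x)))" for v
  proof (rule diff_times_cong[OF assms(1) _ diff_times_add[OF assms(1)]])
    show "diff_times n U (\<lambda>x. b (f x) (dirderiv v g x))" "diff_times n U (\<lambda>x. b (dirderiv v f x) (g x))"
      using Suc.prems diff_times_pred by (auto intro!: Suc.IH simp del: diff_times.simps intro: diff_times_dirderiv)
  qed (use Suc.prems in \<open>auto simp: dirderiv_bilinear[OF assms(2)]\<close>)
  then show ?case using Suc.prems by (auto intro!: differentiable_bilinear[OF assms(2)])
qed (auto intro!: differentiable_bilinear[OF assms(2)])

lemma diff_times_const: "diff_times n (U::'a::real_normed_vector set) (\<lambda>x. c)"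
proof (induction n arbitrary: c)
  case (Suc n c)
  have "dirderiv v (\<lambda>x::'a. c) = (\<lambda>x. 0)" for v by (simp add: dirderiv_def fun_eq_iff)
  then show ?case using Suc by simp
qed simp

lemma diff_times_bounded_linear:
  assumes "bounded_linear T" shows "diff_times n U T"
proof -
  have d: "T differentiable at x" for x
    using bounded_linear_imp_has_derivative[OF assms] by (auto simp: differentiable_def)
  have "dirderiv v T = (\<lambda>x. T v)" for v
    using dirderiv_eqI[OF bounded_linear_imp_has_derivative[OF assms]] by auto
  then show ?thesis using d by (cases n) (simp_all add: diff_times_const)
qed

lemma diff_times_sum:
  assumes "open U" "\<And>i. i \<in> I \<Longrightarrow> diff_times n U (f i)"
  shows "diff_times n U (\<lambda>x. \<Sum>i\<in>I. f i x)"
  using assms(2)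
  by (induction I rule: infinite_finite_induct) (auto intro!: diff_times_const diff_times_add[OF assms(1)])

section \<open>Symmetry of second derivatives\<close>

lemma dirderiv_dirderiv_mean_value:
  fixes f :: "'a::real_normed_vector \<Rightarrow> real"
  assumes "open U" "diff_times 1 U f" "h > 0"
    and U: "\<And>s t. 0 \<le> s \<Longrightarrow> s \<le> h \<Longrightarrow> 0 \<le> t \<Longrightarrow> t \<le> h \<Longrightarrow> x + s *\<^sub>R v + t *\<^sub>R w \<in> U"
  shows "\<exists>s t. 0 \<le> s \<and> s \<le> h \<and> 0 \<le> t \<and> t \<le> h \<and>
    f (x + h *\<^sub>R v + h *\<^sub>R w) - f (x + h *\<^sub>R v) - f (x + h *\<^sub>R w) + f x
      = h * h * dirderiv w (dirderiv v f) (x + s *\<^sub>R v + t *\<^sub>R w)"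
proof -
  have line: "((\<lambda>s. g (y + s *\<^sub>R u)) has_real_derivative dirderiv u g (y + s *\<^sub>R u)) (at s)"
    if "g differentiable at (y + s *\<^sub>R u)" for g :: "'a \<Rightarrow> real" and y u s
  proof -
    have "((\<lambda>s. y + s *\<^sub>R u) has_derivative (\<lambda>r. r *\<^sub>R u)) (at s)"
      by (auto intro!: derivative_eq_intros)
    from has_derivative_compose[OF this has_derivative_dirderiv[OF that]]
    have *: "((\<lambda>s. g (y + s *\<^sub>R u)) has_derivative (\<lambda>r. dirderiv (r *\<^sub>R u) g (y + s *\<^sub>R u))) (at s)" .
    have "dirderiv (r *\<^sub>R u) g (y + s *\<^sub>R u) = dirderiv u g (y + s *\<^sub>R u) * r" for r
      using linear_scale[OF linear_dirderiv[OF that]] by simp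
    with * show ?thesis by (simp add: has_field_derivative_def)
  qed
  have df: "f differentiable at z" "dirderiv v f differentiable at z" if "z \<in> U" for z
    using assms(2) that by (auto simp: numeral_eq_Suc)
  \<comment> \<open>The second difference over the parallelogram is \<open>k h - k 0\<close>. One
    mean value step in direction v and one in direction w produce the mixed derivative, while the
    second difference is symmetric in v and w.\<close>
  define k where "k s = f ((x + h *\<^sub>R w) + s *\<^sub>R v) - f (x + s *\<^sub>R v)" for s
  have "(k has_real_derivative dirderiv v f ((x + h *\<^sub>R w) + s *\<^sub>R v) - dirderiv v f (x + s *\<^sub>R v)) (at s)"
    if "0 \<le> s" "s \<le> h" for s
  proof -
    have "(x + h *\<^sub>R w) + s *\<^sub>R v \<in> U" "x + s *\<^sub>R v \<in> U"
      using U[of s h] U[of s 0] that \<open>h > 0\<close> by (simp_all add: algebra_simps)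
    then show ?thesis unfolding k_def by (intro derivative_intros line df)
  qed
  from MVT2[OF \<open>h > 0\<close> this] obtain s where s: "0 < s" "s < h"
    and ks: "k h - k 0 = h * (dirderiv v f ((x + h *\<^sub>R w) + s *\<^sub>R v) - dirderiv v f (x + s *\<^sub>R v))" by auto
  define l where "l t = dirderiv v f ((x + s *\<^sub>R v) + t *\<^sub>R w)" for t
  have "(l has_real_derivative dirderiv w (dirderiv v f) ((x + s *\<^sub>R v) + t *\<^sub>R w)) (at t)"
    if "0 \<le> t" "t \<le> h" for t
    unfolding l_def by (intro derivative_intros line df) (use U[of s t] that s in simp)
  from MVT2[OF \<open>h > 0\<close> this] obtain t where t: "0 < t" "t < h"
    and lt: "l h - l 0 = h * dirderiv w (dirderiv v f) ((x + s *\<^sub>R v) + t *\<^sub>R w)" by auto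
  have "k h - k 0 = h * (h * dirderiv w (dirderiv v f) (x + s *\<^sub>R v + t *\<^sub>R w))"
    unfolding ks lt[symmetric] l_def by (simp add: algebra_simps)
  then have "f (x + h *\<^sub>R v + h *\<^sub>R w) - f (x + h *\<^sub>R v) - f (x + h *\<^sub>R w) + f x
      = h * h * dirderiv w (dirderiv v f) (x + s *\<^sub>R v + t *\<^sub>R w)"
    unfolding k_def by (simp add: algebra_simps)
  with s t show ?thesis by (intro exI[of _ s] exI[of _ t]) auto
qed

text \<open>Both mixed derivatives, each at some point near x, equal the same second difference
  divided by h * h. Both are continuous at x, so values within half of a supposed gap could not
  coincide.\<close>

lemma dirderiv_commute_real:
  fixes f :: "'a::real_normed_vector \<Rightarrow> real"
  assumes "open U" "diff_times 2 U f" "x \<in> U"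
  shows "dirderiv v (dirderiv w f) x = dirderiv w (dirderiv v f) x"
proof (rule ccontr)
  define p where "p = dirderiv v (dirderiv w f)"
  define q where "q = dirderiv w (dirderiv v f)"
  assume "dirderiv v (dirderiv w f) x \<noteq> dirderiv w (dirderiv v f) x"
  then have e: "\<bar>p x - q x\<bar> / 2 > 0" (is "?e > 0") by (simp add: p_def q_def)
  have "isCont p x" "isCont q x"
    using assms(2,3) unfolding p_def q_def
    by (auto simp: numeral_eq_Suc intro!: differentiable_imp_continuous_within)
  then obtain d1 d2 where d: "d1 > 0" "d2 > 0"
    and p: "\<And>y. dist y x < d1 \<Longrightarrow> dist (p y) (p x) < ?e"
    and q: "\<And>y. dist y x < d2 \<Longrightarrow> dist (q y) (q x) < ?e"
    using e unfolding continuous_at_eps_delta by metis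
  obtain d3 where d3: "d3 > 0" "\<And>y. dist y x < d3 \<Longrightarrow> y \<in> U"
    using assms(1,3) unfolding open_dist by blast
  \<comment> \<open>The choice of \<open>h\<close> keeps the parallelogram within half of the
    smallest radius; the summand 1 makes \<open>m\<close> positive even for v = w = 0.\<close>
  define m where "m = norm v + norm w + 1"
  define h where "h = min d1 (min d2 d3) / (2 * m)"
  have m: "m > 0" unfolding m_def by (simp add: add_nonneg_pos)
  then have h: "h > 0" using d d3 unfolding h_def by simp
  have dist: "dist (x + s *\<^sub>R v + t *\<^sub>R w) x < min d1 (min d2 d3)"
    if "0 \<le> s" "s \<le> h" "0 \<le> t" "t \<le> h" for s t
  proof -
    have "dist (x + s *\<^sub>R v + t *\<^sub>R w) x \<le> s * norm v + t * norm w"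
      using norm_triangle_ineq[of "s *\<^sub>R v" "t *\<^sub>R w"] that by (simp add: dist_norm algebra_simps)
    also have "\<dots> \<le> h * norm v + h * norm w"
      using that by (intro add_mono mult_right_mono) auto
    also have "\<dots> \<le> h * m" using h by (simp add: m_def algebra_simps)
    also have "\<dots> = min d1 (min d2 d3) / 2" using m by (simp add: h_def)
    also have "\<dots> < min d1 (min d2 d3)" using d d3 by (auto simp: min_def)
    finally show ?thesis .
  qed
  have c: "diff_times 1 U f" using assms(2) diff_times_pred[of 1] by (simp add: numeral_2_eq_2)
  obtain s t where st: "0 \<le> s" "s \<le> h" "0 \<le> t" "t \<le> h"
    "f (x + h *\<^sub>R v + h *\<^sub>R w) - f (x + h *\<^sub>R v) - f (x + h *\<^sub>R w) + f x = h * h * q (x + s *\<^sub>R v + t *\<^sub>R w)"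
    using dirderiv_dirderiv_mean_value[OF assms(1) c h, of x v w] d3(2) dist unfolding q_def by fastforce
  have dist': "dist (x + s *\<^sub>R w + t *\<^sub>R v) x < min d1 (min d2 d3)"
    if "0 \<le> s" "s \<le> h" "0 \<le> t" "t \<le> h" for s t
    using dist[of t s] that by (simp add: algebra_simps)
  obtain s' t' where st': "0 \<le> s'" "s' \<le> h" "0 \<le> t'" "t' \<le> h"
    "f (x + h *\<^sub>R w + h *\<^sub>R v) - f (x + h *\<^sub>R w) - f (x + h *\<^sub>R v) + f x = h * h * p (x + s' *\<^sub>R w + t' *\<^sub>R v)"
    using dirderiv_dirderiv_mean_value[OF assms(1) c h, of x w v] d3(2) dist' unfolding p_def by fastforce
  have "h * h * q (x + s *\<^sub>R v + t *\<^sub>R w) = h * h * p (x + s' *\<^sub>R w + t' *\<^sub>R v)"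
    using st(5) st'(5) by (simp add: algebra_simps)
  then have "q (x + s *\<^sub>R v + t *\<^sub>R w) = p (x + s' *\<^sub>R w + t' *\<^sub>R v)" using h by simp
  moreover have "dist (q (x + s *\<^sub>R v + t *\<^sub>R w)) (q x) < ?e" using dist[OF st(1-4)] by (intro q) simp
  moreover have "dist (p (x + s' *\<^sub>R w + t' *\<^sub>R v)) (p x) < ?e" using dist'[OF st'(1-4)] by (intro p) simp
  ultimately show False by (simp add: dist_real_def abs_if split: if_splits)
qed

lemma dirderiv_commute:
  fixes f :: "'a::real_normed_vector \<Rightarrow> 'b::real_inner"
  assumes "open U" "diff_times 2 U f" "x \<in> U"
  shows "dirderiv v (dirderiv w f) x = dirderiv w (dirderiv v f) x"
proof (rule vector_eq_rdot[THEN iffD1, rule_format])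
  fix b :: 'b
  let ?T = "\<lambda>y. y \<bullet> b"
  have T: "bounded_linear ?T" by (rule bounded_linear_inner_left)
  have c: "f differentiable at y" "dirderiv u f differentiable at y" if "y \<in> U" for y u
    using assms(2) that by (auto simp: numeral_eq_Suc)
  have "dirderiv u (dirderiv u' (\<lambda>y. f y \<bullet> b)) x = dirderiv u (dirderiv u' f) x \<bullet> b" for u u'
  proof -
    have "dirderiv u (dirderiv u' (\<lambda>y. f y \<bullet> b)) x = dirderiv u (\<lambda>y. dirderiv u' f y \<bullet> b) x"
      by (rule dirderiv_cong_open(2)[OF assms(1) _ assms(3), symmetric])
         (use c assms(3) in \<open>auto intro!: differentiable_linear_compose[OF T] simp: dirderiv_linear_compose[OF T]\<close>)
    also have "\<dots> = dirderiv u (dirderiv u' f) x \<bullet> b"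
      using c assms(3) by (simp add: dirderiv_linear_compose[OF T])
    finally show ?thesis .
  qed
  with dirderiv_commute_real[OF assms(1) diff_times_linear[OF assms(1) T assms(2)] assms(3), of v w]
  show "dirderiv v (dirderiv w f) x \<bullet> b = dirderiv w (dirderiv v f) x \<bullet> b" by simp
qed

section \<open>The algebra of pairs of matrices\<close>

lemma mat2_eq_iff: "(A::mat2) = B \<longleftrightarrow> A$1$1 = B$1$1 \<and> A$1$2 = B$1$2 \<and> A$2$1 = B$2$1 \<and> A$2$2 = B$2$2"
  by (auto simp: vec_eq_iff forall_2)

lemma mat2_mult_nth: "((A::mat2) ** B) $ i $ j = A$i$1 * B$1$j + A$i$2 * B$2$j"
  by (simp add: matrix_matrix_mult_def sum_2)

lemma adj2_nth: "adj2 A $ 1 $ 1 = A$2$2" "adj2 A $ 1 $ 2 = - A$1$2" "adj2 A $ 2 $ 1 = - A$2$1" "adj2 A $ 2 $ 2 = A$1$1"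
  by (simp_all add: adj2_def)

lemma mat2_one_nth: "(mat r :: mat2) $ 1 $ 1 = r" "(mat r :: mat2) $ 1 $ 2 = 0" "(mat r :: mat2) $ 2 $ 1 = 0" "(mat r :: mat2) $ 2 $ 2 = r"
  by (simp_all add: mat_def)

lemma mat2_vector_nth: "(vector [vector [a, b], vector [c, d]] :: mat2) $ 1 $ 1 = a"
  "(vector [vector [a, b], vector [c, d]] :: mat2) $ 1 $ 2 = b"
  "(vector [vector [a, b], vector [c, d]] :: mat2) $ 2 $ 1 = c"
  "(vector [vector [a, b], vector [c, d]] :: mat2) $ 2 $ 2 = d"
  by simp_all

lemma trace2: "trace (A::mat2) = A$1$1 + A$2$2"
  by (simp add: trace_def sum_2)

lemmas mat2_nth = mat2_mult_nth adj2_nth mat2_one_nth mat2_vector_nth trace2 det_2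

lemma adj2_mult: "adj2 (A ** B) = adj2 B ** adj2 A"
  by (simp add: mat2_eq_iff mat2_nth algebra_simps)

lemma mult_adj2: "A ** adj2 A = mat (det A)" "adj2 A ** A = mat (det A)"
  by (simp_all add: mat2_eq_iff mat2_nth algebra_simps)

lemma mat2_mult_scaleR: "(r *\<^sub>R (A::mat2)) ** (B::mat2) = r *\<^sub>R (A ** B)" "A ** (r *\<^sub>R B) = r *\<^sub>R ((A::mat2) ** B)"
  by (simp_all add: mat2_eq_iff mat2_nth algebra_simps)

lemma mat_eq_scaleR: "mat r = r *\<^sub>R (mat 1 :: mat2)"
  by (simp add: mat2_eq_iff mat2_nth)

text \<open>\<open>matrix_inv\<close> is defined by choice; the polynomial \<open>adj2\<close> takes
  its place, which keeps all later maps polynomial and defined on the whole space of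
  matrices.\<close>

lemma matrix_inv_eq_adj2:
  fixes A :: mat2
  assumes "det A \<noteq> 0"
  shows "matrix_inv A = (1 / det A) *\<^sub>R adj2 A"
proof -
  have 1: "A ** (1 / det A) *\<^sub>R adj2 A = mat 1" "((1 / det A) *\<^sub>R adj2 A) ** A = mat 1"
    using assms by (simp_all add: mat2_mult_scaleR mult_adj2 mat_eq_scaleR[of "det A"])
  then have "A ** matrix_inv A = mat 1 \<and> matrix_inv A ** A = mat 1"
    unfolding matrix_inv_def by (intro someI) auto
  then show ?thesis
    by (metis 1(2) matrix_mul_assoc matrix_mul_lid matrix_mul_rid)
qed

lemma det_adj2 [simp]: "det (adj2 A) = det A"
  by (simp add: mat2_nth)

lemma linear_adj2: "linear adj2"
  by (rule linearI) (simp_all add: mat2_eq_iff mat2_nth)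

definition pm :: "pt \<Rightarrow> pt \<Rightarrow> pt" where
  "pm x y = (fst x ** fst y, snd x ** snd y)"

definition padj :: "pt \<Rightarrow> pt" where
  "padj x = (adj2 (fst x), adj2 (snd x))"

definition pone :: pt where
  "pone = (mat 1, mat 1)"

definition pb :: "pt \<Rightarrow> pt \<Rightarrow> pt" where
  "pb x y = pm x y - pm y x"

text \<open>The Lie algebra of N; \<open>J0\<close> and \<open>g0\<close> below are the structure of
  N read in it by left translation.\<close>

definition trless :: "pt set" where
  "trless = {x. trace (fst x) = 0 \<and> trace (snd x) = 0}"

definition J0 :: "pt \<Rightarrow> pt" where
  "J0 x = (1 / sqrt 3) *\<^sub>R (fst x - 2 *\<^sub>R snd x, 2 *\<^sub>R fst x - snd x)"

definition g0 :: "pt \<Rightarrow> pt \<Rightarrow> real" where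
  "g0 x y = (2/3) * (br (fst x) (fst y) + br (snd x) (snd y))
     - (1/3) * (br (snd x) (fst y) + br (fst x) (snd y))"

text \<open>In the description of N as the 3-symmetric space \<open>G^3 / \<Delta> G\<close>, \<open>mu\<close> is the projection
  to the isotropy algebra (pulled back by the section \<open>(p, q) \<mapsto> (p, q, 1)\<close>). Hence
  \<open>X \<mapsto> D X + pb (mu X)\<close> is the canonical Hermitian connection and \<open>tor\<close> is its torsion.\<close>

definition mu :: "pt \<Rightarrow> pt" where
  "mu x = ((1/3) *\<^sub>R (fst x + snd x), (1/3) *\<^sub>R (fst x + snd x))"

definition tor :: "pt \<Rightarrow> pt \<Rightarrow> pt" where
  "tor x y = pb (mu x) y - pb (mu y) x - pb x y"

lemma pt_eq_iff: "(x::pt) = y \<longleftrightarrow> fst x = fst y \<and> snd x = snd y"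
  by (rule prod_eq_iff)

interpretation pm: bounded_bilinear pm
proof -
  have "bilinear pm"
    unfolding bilinear_def
    by (intro conjI allI linearI) (simp_all add: pm_def pt_eq_iff mat2_eq_iff mat2_mult_nth algebra_simps)
  then show "bounded_bilinear pm" by (simp add: bilinear_conv_bounded_bilinear)
qed

interpretation pb: bounded_bilinear pb
proof -
  have "bilinear pb"
    unfolding bilinear_def
    by (intro conjI allI linearI)
       (simp_all add: pb_def pm.add_left pm.add_right pm.scaleR_left pm.scaleR_right algebra_simps)
  then show "bounded_bilinear pb" by (simp add: bilinear_conv_bounded_bilinear)
qed

lemma br_eq: "br a b = (a$1$2 * b$2$1 + a$2$1 * b$1$2 - a$2$2 * b$1$1 - a$1$1 * b$2$2) / 2"
  by (simp add: br_def mat2_nth field_simps)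

interpretation g0: bounded_bilinear g0
proof -
  have "bilinear g0"
    unfolding bilinear_def by (intro conjI allI linearI) (simp_all add: g0_def br_eq field_simps)
  then show "bounded_bilinear g0" by (simp add: bilinear_conv_bounded_bilinear)
qed

lemma linear_mu: "linear mu"
  by (rule linearI) (simp_all add: mu_def pt_eq_iff algebra_simps)

lemma linear_J0: "linear J0"
  by (rule linearI) (simp_all add: J0_def pt_eq_iff algebra_simps)

lemma linear_padj: "linear padj"
  by (rule linearI)
     (simp_all add: padj_def pt_eq_iff linear_add[OF linear_adj2] linear_scale[OF linear_adj2])

lemmas mu_linear = linear_add[OF linear_mu] linear_diff[OF linear_mu] linear_scale[OF linear_mu]
lemmas J0_linear = linear_add[OF linear_J0] linear_diff[OF linear_J0] linear_scale[OF linear_J0]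

interpretation tor: bounded_bilinear tor
proof -
  have "bilinear tor"
    unfolding bilinear_def
    by (intro conjI allI linearI)
       (simp_all add: tor_def pb.add_left pb.add_right pb.scaleR_left pb.scaleR_right mu_linear algebra_simps)
  then show "bounded_bilinear tor" by (simp add: bilinear_conv_bounded_bilinear)
qed

lemma pm_assoc: "pm (pm x y) z = pm x (pm y z)"
  by (simp add: pm_def matrix_mul_assoc)

lemma pm_pone [simp]: "pm x pone = x" "pm pone x = x"
  by (simp_all add: pm_def pone_def)

lemma NN_iff: "p \<in> NN \<longleftrightarrow> det (fst p) = 1 \<and> det (snd p) = 1"
  by (cases p) (simp add: NN_def SL2_def)

lemma pm_padj: "p \<in> NN \<Longrightarrow> pm p (padj p) = pone" "p \<in> NN \<Longrightarrow> pm (padj p) p = pone"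
  by (simp_all add: NN_iff pm_def padj_def pone_def mult_adj2)

lemma pm_padj_left: "p \<in> NN \<Longrightarrow> pm p (pm (padj p) x) = x" "p \<in> NN \<Longrightarrow> pm (padj p) (pm p x) = x"
  by (simp_all add: pm_padj flip: pm_assoc)

lemma pone_in_NN: "pone \<in> NN"
  by (simp add: pone_def NN_iff)

lemma pm_in_NN: "p \<in> NN \<Longrightarrow> q \<in> NN \<Longrightarrow> pm p q \<in> NN"
  by (simp add: NN_iff pm_def det_mul)

lemma subspace_trless: "subspace trless"
  by (auto simp: subspace_def trless_def trace2 simp flip: distrib_left add.assoc)

section \<open>Invariance properties of the metric, the complex structure and the torsion\<close>

lemma pb_jacobi: "pb x (pb y z) = pb (pb x y) z + pb y (pb x z)"
  by (simp add: pb_def pm.diff_left pm.diff_right pm_assoc)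

lemma pb_skew: "pb x y = - pb y x"
  by (simp add: pb_def)

lemma trless_closed:
  assumes "x \<in> trless"
  shows "mu x \<in> trless" "J0 x \<in> trless"
proof -
  have "(fst x + snd x, fst x + snd x) \<in> trless" "(fst x - 2 *\<^sub>R snd x, 2 *\<^sub>R fst x - snd x) \<in> trless"
    using assms by (simp_all add: trless_def trace2)
  from this[THEN subspace_scale[OF subspace_trless]]
  show "mu x \<in> trless" "J0 x \<in> trless" by (auto simp: mu_def J0_def simp del: scaleR_Pair simp flip: scaleR_Pair)
qed

lemma pb_trless: "pb x y \<in> trless"
  by (simp add: trless_def pb_def pm_def trace2 mat2_mult_nth)

lemma tor_trless: "tor x y \<in> trless"
  unfolding tor_def by (intro subspace_diff[OF subspace_trless] pb_trless)

text \<open>\<open>J0\<close> mixes the two components with scalar coefficients and bracketing with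
  a diagonal pair acts alike on both, so the canonical connection preserves J.\<close>

lemma J0_pb_mu: "J0 (pb (mu x) y) = pb (mu x) (J0 y)"
proof -
  define m where "m = (1/3) *\<^sub>R (fst x + snd x)"
  have "(fst (pb (m, m) y) - 2 *\<^sub>R snd (pb (m, m) y), 2 *\<^sub>R fst (pb (m, m) y) - snd (pb (m, m) y))
      = pb (m, m) (fst y - 2 *\<^sub>R snd y, 2 *\<^sub>R fst y - snd y)"
    by (simp add: pb_def pm_def pt_eq_iff mat2_eq_iff mat2_mult_nth algebra_simps)
  then show ?thesis unfolding J0_def mu_def m_def[symmetric] pb.scaleR_right by simp
qed

lemma J0_J0: "J0 (J0 x) = - x"
  by (simp add: J0_def pt_eq_iff mat2_eq_iff field_simps)

lemma br_commute: "br a b = br b a"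
  by (simp add: br_eq)

lemma g0_commute: "g0 x y = g0 y x"
  by (simp add: g0_def br_commute)

lemma g0_J0: "g0 (J0 x) y = - g0 x (J0 y)"
  by (simp add: g0_def J0_def br_eq field_simps)

lemma br_invariant: "br (x ** a - a ** x) b = - br a (x ** b - b ** x)"
  by (simp add: br_eq mat2_mult_nth field_simps)

lemma g0_pb_mu: "g0 (pb (mu x) y) z = - g0 y (pb (mu x) z)"
  by (simp add: g0_def pb_def pm_def mu_def br_invariant algebra_simps)

lemma tor_skew: "tor x y = - tor y x"
  unfolding tor_def using pb_skew[of x y] by simp

text \<open>For x = (x1, x2), y = (y1, y2) the components are ([x2,y1] + [x1,y2] - [x1,y1]) / 3 and
  ([x1,y2] + [x2,y1] - [x2,y2]) / 3. Padding with 0 only serves to write mixed brackets through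
  \<open>pb\<close>.\<close>

lemma tor_eq: "tor x y = (1/3) *\<^sub>R
    (fst (pb (snd x, 0) y + pb (fst x, 0) (snd y, 0) - pb x y),
     snd (pb (0, fst x) y + pb (0, snd x) (0, fst y) - pb x y))"
proof -
  have "mu z = (1/3) *\<^sub>R (fst z + snd z, fst z + snd z)" for z by (simp add: mu_def)
  moreover have "pb x y = (1/3) *\<^sub>R (3 *\<^sub>R pb x y)" by simp
  moreover have "pb (fst x + snd x, fst x + snd x) y - pb (fst y + snd y, fst y + snd y) x - 3 *\<^sub>R pb x y
    = (fst (pb (snd x, 0) y + pb (fst x, 0) (snd y, 0) - pb x y),
     snd (pb (0, fst x) y + pb (0, snd x) (0, fst y) - pb x y))"
    by (simp add: pb_def pm_def pt_eq_iff mat2_eq_iff mat2_mult_nth algebra_simps)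
  ultimately show ?thesis
    unfolding tor_def by (metis (no_types) pb.scaleR_left scaleR_diff_right)
qed

lemma tor_J0: "tor x (J0 y) = - J0 (tor x y)"
proof -
  \<comment> \<open>Stripping the factors 1/3 and 1 / sqrt 3 leaves an identity with integer
    coefficients in the matrix entries.\<close>
  define t where "t x y = (fst (pb (snd x, 0) y + pb (fst x, 0) (snd y, 0) - pb x y),
     snd (pb (0, fst x) y + pb (0, snd x) (0, fst y) - pb x y))" for x y
  define J1 where "J1 x = (fst x - 2 *\<^sub>R snd x, 2 *\<^sub>R fst x - snd x)" for x :: pt
  have J: "J0 z = (1 / sqrt 3) *\<^sub>R J1 z" for z by (simp add: J0_def J1_def)
  have T: "tor x z = (1/3) *\<^sub>R t x z" for z by (simp add: tor_eq t_def)
  have "t x (J1 y) = - J1 (t x y)"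
    by (simp add: t_def J1_def pb_def pm_def pt_eq_iff mat2_eq_iff mat2_mult_nth algebra_simps)
  then show ?thesis
    by (simp add: J tor.scaleR_right T linear_scale[OF linear_J0] del: scaleR_left_diff_distrib)
       (simp add: J1_def algebra_simps)
qed

text \<open>Together with \<open>tor_skew\<close> this is total skewness. The factor 6 clears the
  denominators of \<open>g0\<close>, with \<open>B\<close> being twice \<open>br\<close>.\<close>

lemma g0_tor: "g0 (tor x y) z = - g0 y (tor x z)"
proof -
  define B :: "mat2 \<Rightarrow> mat2 \<Rightarrow> real"
    where "B a b = a$1$2 * b$2$1 + a$2$1 * b$1$2 - a$2$2 * b$1$1 - a$1$1 * b$2$2" for a b
  have g: "6 * g0 u v = 2 * (B (fst u) (fst v) + B (snd u) (snd v)) - (B (snd u) (fst v) + B (fst u) (snd v))" for u v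
    by (simp add: g0_def B_def br_eq field_simps)
  define t where "t x y = (fst (pb (snd x, 0) y + pb (fst x, 0) (snd y, 0) - pb x y),
     snd (pb (0, fst x) y + pb (0, snd x) (0, fst y) - pb x y))" for x y
  have T: "tor x z = (1/3) *\<^sub>R t x z" for z by (simp add: tor_eq t_def)
  have "6 * g0 (t x y) z = - (6 * g0 y (t x z))"
    unfolding g by (simp add: B_def t_def pb_def pm_def mat2_mult_nth algebra_simps)
  then show ?thesis by (simp add: T g0.scaleR_left g0.scaleR_right)
qed

lemma g0_nondegenerate:
  assumes x: "x \<in> trless" and "\<And>y. y \<in> trless \<Longrightarrow> g0 x y = 0"
  shows "x = 0"
proof -
  define h e f :: mat2 where "h = vector [vector [1, 0], vector [0, -1]]"
    and "e = vector [vector [0, 1], vector [0, 0]]" and "f = vector [vector [0, 0], vector [1, 0]]"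
  have "(n, 0) \<in> trless" "(0, n) \<in> trless" if "n \<in> {h, e, f}" for n
    using that by (auto simp: trless_def trace2 h_def e_def f_def)
  then have *: "g0 x (n, 0) = 0" "g0 x (0, n) = 0" if "n \<in> {h, e, f}" for n
    using assms(2) that by auto
  show ?thesis
    using *[of h] *[of e] *[of f] x
    by (simp add: g0_def br_eq h_def e_def f_def trless_def trace2 pt_eq_iff mat2_eq_iff)
qed

section \<open>Metric connections with torsion\<close>

lemma linear_trless_surj:
  assumes L: "linear L" and W: "\<And>x. x \<in> trless \<Longrightarrow> L x \<in> trless"
    and g: "\<And>x y. x \<in> trless \<Longrightarrow> y \<in> trless \<Longrightarrow> g0 (L x) (L y) = g0 x y"
  shows "inj_on L trless" "L ` trless = trless"
proof -
  have z: "x = 0" if "x \<in> trless" "L x = 0" for x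
    using g0_nondegenerate[of x] g[OF that(1)] that by (simp add: g0.zero_left)
  show inj: "inj_on L trless"
    using L subspace_trless z by (simp add: linear_inj_on_iff_eq_0)
  have "dim (L ` trless) = dim trless"
    using dim_image_eq[OF L, of trless] inj by (simp add: span_eq_iff[THEN iffD2, OF subspace_trless])
  then show "L ` trless = trless"
    by (intro subspace_dim_equal linear_subspace_image L subspace_trless) (use W in auto)
qed

text \<open>The uniqueness of a metric connection with given torsion, in the form of the Koszul
  argument: up to the term \<open>\<sigma> / 2\<close> the form \<open>g0 (d y x) (L z)\<close> is symmetric in \<open>x, y\<close> and skew
  in \<open>x, z\<close>. Complex linearity then forces \<open>\<sigma> = 0\<close> because \<open>tor\<close> is complex antilinear.\<close>

lemma koszul:
  fixes L :: "pt \<Rightarrow> pt" and b :: "pt \<Rightarrow> pt \<Rightarrow> pt"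
  assumes L: "linear L" and W: "\<And>x. x \<in> trless \<Longrightarrow> L x \<in> trless"
    and g: "\<And>x y. x \<in> trless \<Longrightarrow> y \<in> trless \<Longrightarrow> g0 (L x) (L y) = g0 x y"
    and J: "\<And>x. x \<in> trless \<Longrightarrow> L (J0 x) = \<epsilon> *\<^sub>R J0 (L x)" and \<epsilon>: "\<epsilon> = 1 \<or> \<epsilon> = -1"
    and bW: "\<And>x y. x \<in> trless \<Longrightarrow> y \<in> trless \<Longrightarrow> b x y \<in> trless"
    and bg: "\<And>x y z. x \<in> trless \<Longrightarrow> y \<in> trless \<Longrightarrow> z \<in> trless \<Longrightarrow> g0 (b z x) (L y) + g0 (L x) (b z y) = 0"
    and bJ: "\<And>x y. x \<in> trless \<Longrightarrow> y \<in> trless \<Longrightarrow> b x (J0 y) = \<epsilon> *\<^sub>R J0 (b x y)"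
    and bb: "\<And>x y. x \<in> trless \<Longrightarrow> y \<in> trless \<Longrightarrow> b y x - b x y = L (pb y x) - pb (L y) (L x)"
    and x: "x \<in> trless" and y: "y \<in> trless"
  shows "b y x = L (pb (mu y) x) - pb (mu (L y)) (L x)" "tor (L y) (L x) = L (tor y x)"
proof -
  \<comment> \<open>\<open>d\<close> is the failure of \<open>L\<close> to be parallel and
    \<open>S\<close> its failure to preserve the torsion; \<open>s\<close> and
    \<open>\<sigma>\<close> are the corresponding trilinear forms.\<close>
  define d where "d y x = b y x - L (pb (mu y) x) + pb (mu (L y)) (L x)" for y x
  define s where "s y x z = g0 (d y x) (L z)" for x y z
  define S where "S y x = tor (L y) (L x) - L (tor y x)" for y x
  define \<sigma> where "\<sigma> y x z = g0 (S y x) (L z)" for x y z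
  note J0W = trless_closed(2)
  have \<epsilon>2: "\<epsilon> * \<epsilon> = 1" using \<epsilon> by auto
  have lin: "L (u - v) = L u - L v" "L (u + v) = L u + L v" "L (- u) = - L u" for u v
    using L by (simp_all add: linear_diff linear_neg linear_add)
  have sym: "s y x z - s x y z = \<sigma> y x z" if "x \<in> trless" "y \<in> trless" for x y z
  proof -
    have "d y x - d x y = S y x"
      using bb[OF that] by (simp add: d_def S_def tor_def lin algebra_simps)
    then show ?thesis unfolding s_def \<sigma>_def by (simp flip: g0.diff_left)
  qed
  have skew: "s y x z = - s y z x" if "x \<in> trless" "y \<in> trless" "z \<in> trless" for x y z
  proof -
    have "g0 (L (pb (mu y) x)) (L z) = - g0 (L x) (L (pb (mu y) z))"
      using that by (simp add: g pb_trless g0_pb_mu)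
    moreover have "g0 (pb (mu (L y)) (L x)) (L z) = - g0 (L x) (pb (mu (L y)) (L z))"
      by (rule g0_pb_mu)
    ultimately show ?thesis
      using bg[of x z y] that unfolding s_def d_def
      by (simp add: g0.add_left g0.diff_left g0.add_right g0.diff_right g0_commute[of _ "L x"])
  qed
  have \<sigma>_eq: "\<sigma> y x z = g0 (tor (L y) (L x)) (L z) - g0 (tor y x) z" if "z \<in> trless" for x y z
    unfolding \<sigma>_def S_def using that by (simp add: g0.diff_left g tor_trless)
  have \<sigma>skew: "\<sigma> y x z = - \<sigma> y z x" if "x \<in> trless" "z \<in> trless" for x y z
    using that by (simp add: \<sigma>_eq g0_tor[of "L y" "L x" "L z"] g0_tor[of y x z]
        g0_commute[of "L x" "tor (L y) (L z)"] g0_commute[of x "tor y z"])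
  have \<sigma>skew': "\<sigma> y x z = - \<sigma> x y z" if "z \<in> trless" for x y z
    using that by (simp add: \<sigma>_eq tor_skew[of "L y"] tor_skew[of y] g0.minus_left)
  \<comment> \<open>Half of \<open>\<sigma>\<close> is exactly what makes the form symmetric in its
    first two slots while it stays skew in the last two. Alternating the two symmetries three times
    returns the form with the opposite sign.\<close>
  define r where "r y x z = s y x z - \<sigma> y x z / 2" for x y z
  have "r y x z = 0" if "x \<in> trless" "y \<in> trless" "z \<in> trless" for x y z
  proof -
    have 1: "r y x z = r x y z" if "x \<in> trless" "y \<in> trless" "z \<in> trless" for x y z
      using sym[OF that(1,2), of z] \<sigma>skew'[OF that(3), of y x] unfolding r_def by (simp add: field_simps)
    have 2: "r y x z = - r y z x" if "x \<in> trless" "y \<in> trless" "z \<in> trless" for x y z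
      using skew[OF that] \<sigma>skew[OF that(1,3), of y] unfolding r_def by simp
    show ?thesis
      using 1[of x y z] 2[of y x z] 1[of z x y] 2[of x z y] 1[of y z x] 2[of z y x] that by simp
  qed
  then have s_eq: "s y x z = \<sigma> y x z / 2" if "x \<in> trless" "y \<in> trless" "z \<in> trless" for x y z
    using that unfolding r_def by fastforce
  have sJ: "s y (J0 x) z = - s y x (J0 z)" if "x \<in> trless" "y \<in> trless" "z \<in> trless" for x y z
  proof -
    have "d y (J0 x) = \<epsilon> *\<^sub>R J0 (d y x)"
      using that unfolding d_def
      by (simp add: J0_linear bJ J J0_pb_mu[symmetric] pb_trless pb.scaleR_right algebra_simps)
    then show ?thesis unfolding s_def using that
      by (simp add: J g0_J0 g0.scaleR_left g0.scaleR_right)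
  qed
  have \<sigma>J: "\<sigma> y (J0 x) z = \<sigma> y x (J0 z)" if "x \<in> trless" "z \<in> trless" for x y z
    using that by (simp add: \<sigma>_eq J0W J tor_J0 tor.scaleR_right g0_J0 g0.minus_left g0.scaleR_left g0.scaleR_right)
  have \<sigma>0: "\<sigma> y x z = 0" if "x \<in> trless" "y \<in> trless" "z \<in> trless" for x y z
  proof -
    \<comment> \<open>Moving J from x to z changes the sign of \<open>s\<close> but not of
      \<open>\<sigma>\<close>, although \<open>s\<close> is half of \<open>\<sigma>\<close>.\<close>
    have *: "\<sigma> y x (J0 z) = 0" if "x \<in> trless" "y \<in> trless" "z \<in> trless" for x y z
      using sJ[OF that] \<sigma>J[OF that(1,3), of y] that by (simp add: s_eq J0W)
    have "\<sigma> y x (J0 (J0 z)) = 0" by (rule *) (use that J0W in auto)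
    then show ?thesis unfolding \<sigma>_def J0_J0 by (simp add: lin g0.minus_right)
  qed
  have nd: "u = 0" if "u \<in> trless" "\<And>z. z \<in> trless \<Longrightarrow> g0 u (L z) = 0" for u
  proof (rule g0_nondegenerate[OF that(1)])
    fix y assume "y \<in> trless"
    then show "g0 u y = 0" using that(2) linear_trless_surj(2)[OF L W g] by force
  qed
  have "S y x = 0"
    by (rule nd) (use \<sigma>0 x y in \<open>auto simp: S_def \<sigma>_def W tor_trless subspace_diff[OF subspace_trless]\<close>)
  then show "tor (L y) (L x) = L (tor y x)" by (simp add: S_def)
  have "d y x = 0"
  proof (rule nd)
    show "d y x \<in> trless" unfolding d_def
      using x y by (intro subspace_diff[OF subspace_trless] subspace_add[OF subspace_trless] bW W pb_trless)
    show "g0 (d y x) (L z) = 0" if "z \<in> trless" for z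
      using s_eq[OF x y that] \<sigma>0[OF x y that] by (simp add: s_def)
  qed
  moreover have "b y x = d y x + (L (pb (mu y) x) - pb (mu (L y)) (L x))" by (simp add: d_def)
  ultimately show "b y x = L (pb (mu y) x) - pb (mu (L y)) (L x)" by simp
qed

section \<open>Left-invariant derivatives and the structure equation\<close>

declare diff_times.simps [simp del]

text \<open>For these n the line \<open>pone + t n\<close> is the one-parameter group exp (t n),
  since n squares to zero.\<close>

definition nilp :: "pt set" where
  "nilp = {n. n \<in> trless \<and> det (fst n) = 0 \<and> det (snd n) = 0}"

lemma nilp_trless: "n \<in> nilp \<Longrightarrow> n \<in> trless"
  by (simp add: nilp_def)

lemma trless_subset_span_nilp: "trless \<subseteq> span nilp"
proof
  fix x assume x: "x \<in> trless"
  \<comment> \<open>\<open>g\<close> replaces the diagonal matrix diag(1, -1), which is not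
    nilpotent but equals g + e - f.\<close>
  define e f g :: mat2 where "e = vector [vector [0, 1], vector [0, 0]]"
    and "f = vector [vector [0, 0], vector [1, 0]]" and "g = vector [vector [1, -1], vector [1, -1]]"
  have 1: "(n, 0) \<in> span nilp" "(0, n) \<in> span nilp" if "n \<in> {e, f, g}" for n
    using that by (auto intro!: span_base simp: nilp_def trless_def mat2_nth e_def f_def g_def)
  define c where "c a = (a$1$2 + a$1$1) *\<^sub>R e + (a$2$1 - a$1$1) *\<^sub>R f + a$1$1 *\<^sub>R g" for a :: mat2
  have "(c a, 0) = (a$1$2 + a$1$1) *\<^sub>R (e, 0) + (a$2$1 - a$1$1) *\<^sub>R (f, 0) + a$1$1 *\<^sub>R (g, 0::mat2)"
    "(0, c a) = (a$1$2 + a$1$1) *\<^sub>R (0, e) + (a$2$1 - a$1$1) *\<^sub>R (0, f) + a$1$1 *\<^sub>R (0::mat2, g)" for a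
    by (simp_all add: c_def)
  then have 2: "(c a, 0) \<in> span nilp" "(0, c b) \<in> span nilp" for a b
    by (simp_all only:) (intro span_add span_scale 1; simp)+
  have "x = (c (fst x), 0) + (0, c (snd x))"
    using x by (simp add: pt_eq_iff mat2_eq_iff c_def e_def f_def g_def trless_def trace2)
  then show "x \<in> span nilp" using span_add[OF 2] by metis
qed

lemma det_one_plus_nilpotent:
  fixes A :: mat2
  assumes "trace A = 0" "det A = 0"
  shows "det (mat 1 + t *\<^sub>R A) = 1"
proof -
  have "det (mat 1 + t *\<^sub>R A) = 1 + t * trace A + t * t * det A"
    by (simp add: mat2_nth algebra_simps)
  then show ?thesis using assms by simp
qed

lemma one_plus_nilp_in_NN: "n \<in> nilp \<Longrightarrow> pone + t *\<^sub>R n \<in> NN"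
  by (simp add: NN_iff pone_def nilp_def trless_def det_one_plus_nilpotent)

lemma nilp_square: "n \<in> nilp \<Longrightarrow> pm n n = 0"
proof -
  have "A ** A = 0" if "trace A = 0" "det A = 0" for A :: mat2
  proof -
    have "A$2$2 = - A$1$1" using that(1) by (simp add: trace2)
    then show ?thesis using that(2) by (simp add: mat2_eq_iff mat2_nth algebra_simps)
  qed
  then show "n \<in> nilp \<Longrightarrow> pm n n = 0" by (simp add: nilp_def trless_def pm_def zero_prod_def)
qed

lemma line_has_vector_derivative:
  assumes "f differentiable at (p + t *\<^sub>R v)"
  shows "((\<lambda>t. f (p + t *\<^sub>R v)) has_vector_derivative dirderiv v f (p + t *\<^sub>R v)) (at t)"
proof -
  have "((\<lambda>t. p + t *\<^sub>R v) has_derivative (\<lambda>r. r *\<^sub>R v)) (at t)"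
    by (auto intro!: derivative_eq_intros)
  from has_derivative_compose[OF this has_derivative_dirderiv[OF assms]]
  show ?thesis
    by (simp add: has_vector_derivative_def linear_scale[OF linear_dirderiv[OF assms]])
qed

text \<open>Derivative along the left-invariant field p x. As the field is linear in p, the formula
  also makes sense off N, where extensions live.\<close>

definition lderiv :: "pt \<Rightarrow> (pt \<Rightarrow> 'b::real_normed_vector) \<Rightarrow> pt \<Rightarrow> 'b" where
  "lderiv x f p = dirderiv (pm p x) f p"

lemma linear_lderiv:
  assumes "f differentiable at p" shows "linear (\<lambda>x. lderiv x f p)"
  using linear_compose[OF bounded_linear.linear[OF pm.bounded_linear_right] linear_dirderiv[OF assms]]
  by (simp add: lderiv_def o_def)

text \<open>This licenses differentiation of identities known only on N: in a nilpotent direction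
  the two functions agree on a whole line, and linearity in the direction covers the span.\<close>

lemma lderiv_tangential:
  fixes f g :: "pt \<Rightarrow> 'b::real_normed_vector"
  assumes eq: "\<And>q. q \<in> NN \<Longrightarrow> f q = g q" and p: "p \<in> NN" and x: "x \<in> trless"
    and d: "f differentiable at p" "g differentiable at p"
  shows "lderiv x f p = lderiv x g p"
proof -
  have "lderiv n f p = lderiv n g p" if n: "n \<in> nilp" for n
  proof -
    have "p + t *\<^sub>R pm p n = pm p (pone + t *\<^sub>R n)" for t
      by (simp add: pm.add_right pm.scaleR_right)
    then have "f (p + t *\<^sub>R pm p n) = g (p + t *\<^sub>R pm p n)" for t
      using pm_in_NN[OF p one_plus_nilp_in_NN[OF n]] by (auto intro: eq)
    then have "((\<lambda>t. f (p + t *\<^sub>R pm p n)) has_vector_derivative lderiv n g p) (at 0)"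
      using line_has_vector_derivative[of g p 0 "pm p n"] d by (simp add: lderiv_def)
    moreover have "((\<lambda>t. f (p + t *\<^sub>R pm p n)) has_vector_derivative lderiv n f p) (at 0)"
      using line_has_vector_derivative[of f p 0 "pm p n"] d by (simp add: lderiv_def)
    ultimately show ?thesis by (intro vector_derivative_unique_at)
  qed
  then show ?thesis
    using linear_eq_on_span[OF linear_lderiv[OF d(1)] linear_lderiv[OF d(2)], of nilp]
      trless_subset_span_nilp x by blast
qed

lemma dirderiv_eq_sum:
  fixes f :: "'a::euclidean_space \<Rightarrow> 'b::real_normed_vector"
  assumes "f differentiable at p"
  shows "dirderiv v f p = (\<Sum>b\<in>Basis. (v \<bullet> b) *\<^sub>R dirderiv b f p)"
proof -
  have "dirderiv v f p = dirderiv (\<Sum>b\<in>Basis. (v \<bullet> b) *\<^sub>R b) f p" by (simp add: euclidean_representation)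
  also have "\<dots> = (\<Sum>b\<in>Basis. (v \<bullet> b) *\<^sub>R dirderiv b f p)"
    using linear_sum[OF linear_dirderiv[OF assms], of "\<lambda>b. (v \<bullet> b) *\<^sub>R b" Basis]
    by (simp add: linear_scale[OF linear_dirderiv[OF assms]])
  finally show ?thesis .
qed

text \<open>The direction of \<open>lderiv\<close> moves with the point. Expansion in the ambient
  basis turns it into linear coefficients times derivatives in fixed directions; the product rule
  then gives the extra term from the moving direction.\<close>

lemma
  assumes U: "open U" and f: "diff_times (Suc n) U f"
  shows diff_times_lderiv: "diff_times n U (lderiv x f)"
    and dirderiv_lderiv: "p \<in> U \<Longrightarrow>
      dirderiv v (lderiv x f) p = dirderiv v (dirderiv (pm p x) f) p + dirderiv (pm v x) f p"
proof -
  note scaleR = bounded_bilinear_scaleR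
  define g where "g b q = (pm q x \<bullet> b) *\<^sub>R dirderiv b f q" for b q
  have lin: "bounded_linear (\<lambda>q. pm q x \<bullet> b)" for b
    using bounded_linear_compose[OF bounded_linear_inner_left pm.bounded_linear_left] .
  have g: "diff_times n U (g b)" for b
    unfolding g_def by (rule diff_times_bilinear[OF U scaleR diff_times_bounded_linear[OF lin] diff_times_dirderiv[OF f]])
  have fd: "q \<in> U \<Longrightarrow> f differentiable at q" for q by (rule diff_times_differentiable[OF f])
  have eq: "(\<Sum>b\<in>Basis. g b q) = lderiv x f q" if "q \<in> U" for q
    unfolding lderiv_def g_def using dirderiv_eq_sum[OF fd[OF that], of "pm q x"] by simp
  show "diff_times n U (lderiv x f)"
    by (rule diff_times_cong[OF U eq diff_times_sum[OF U g]])
  assume p: "p \<in> U"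
  have fd': "dirderiv b f differentiable at p" for b
    by (rule diff_times_differentiable[OF diff_times_dirderiv[OF f] p])
  have dg: "dirderiv v (g b) p = (pm p x \<bullet> b) *\<^sub>R dirderiv v (dirderiv b f) p + (pm v x \<bullet> b) *\<^sub>R dirderiv b f p" for b
    unfolding g_def
    using dirderiv_bilinear[OF scaleR bounded_linear_imp_differentiable[OF lin] fd', of v b]
      dirderiv_eqI[OF bounded_linear_imp_has_derivative[OF lin], of v b p] by simp
  have "dirderiv v (lderiv x f) p = dirderiv v (\<lambda>q. \<Sum>b\<in>Basis. g b q) p"
    by (rule dirderiv_cong_open(2)[OF U eq p diff_times_differentiable[OF diff_times_sum[OF U g] p], symmetric])
  also have "\<dots> = (\<Sum>b\<in>Basis. dirderiv v (g b) p)"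
    by (rule dirderiv_eqI[OF has_derivative_sum[OF has_derivative_dirderiv]])
       (use diff_times_differentiable[OF g p] in auto)
  also have "\<dots> = (\<Sum>b\<in>Basis. (pm p x \<bullet> b) *\<^sub>R dirderiv v (dirderiv b f) p) + dirderiv (pm v x) f p"
    by (simp add: dg sum.distrib dirderiv_eq_sum[OF fd[OF p], of "pm v x"])
  also have "(\<Sum>b\<in>Basis. (pm p x \<bullet> b) *\<^sub>R dirderiv v (dirderiv b f) p)
    = dirderiv v (\<lambda>q. \<Sum>b\<in>Basis. (pm p x \<bullet> b) *\<^sub>R dirderiv b f q) p"
    by (rule dirderiv_eqI[symmetric, OF has_derivative_sum[OF has_derivative_scaleR_right[OF has_derivative_dirderiv]]])
       (use fd' in auto)
  also have "\<dots> = dirderiv v (dirderiv (pm p x) f) p"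
    by (rule dirderiv_cong_open(2)[OF U _ p, symmetric]) (use fd' dirderiv_eq_sum[OF fd] in auto)
  finally show "dirderiv v (lderiv x f) p = dirderiv v (dirderiv (pm p x) f) p + dirderiv (pm v x) f p" .
qed

text \<open>The second-order parts cancel by symmetry; what survives are the two terms from the
  moving directions.\<close>

lemma lderiv_commutator:
  fixes f :: "pt \<Rightarrow> 'b::real_inner"
  assumes U: "open U" and f: "diff_times (Suc (Suc 0)) U f" and p: "p \<in> U"
  shows "lderiv y (lderiv x f) p - lderiv x (lderiv y f) p = lderiv (pb y x) f p"
proof -
  have f2: "diff_times 2 U f" using f by (simp only: numeral_2_eq_2)
  have lin: "linear (\<lambda>v. dirderiv v f p)" using f p by (intro linear_dirderiv diff_times_differentiable)
  show ?thesis
    using linear_diff[OF lin, of "pm p (pm y x)" "pm p (pm x y)"] dirderiv_lderiv[OF U f p, of "pm p y" x] dirderiv_lderiv[OF U f p, of "pm p x" y]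
      dirderiv_commute[OF U f2 p, of "pm p x" "pm p y"]
    unfolding lderiv_def by (simp add: pb_def pm.diff_right pm_assoc)
qed

lemma lderiv_linear_compose:
  "linear T \<Longrightarrow> f differentiable at p \<Longrightarrow> lderiv x (\<lambda>q. T (f q)) p = T (lderiv x f p)"
  for T :: "'b::euclidean_space \<Rightarrow> 'c::euclidean_space"
  unfolding lderiv_def by (intro dirderiv_linear_compose linear_conv_bounded_linear[THEN iffD1])

lemma lderiv_bilinear:
  "bounded_bilinear b \<Longrightarrow> f differentiable at p \<Longrightarrow> g differentiable at p \<Longrightarrow>
    lderiv x (\<lambda>q. b (f q) (g q)) p = b (f p) (lderiv x g p) + b (lderiv x f p) (g p)"
  unfolding lderiv_def by (rule dirderiv_bilinear)

lemma lderiv_diff: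
  "f differentiable at p \<Longrightarrow> g differentiable at p \<Longrightarrow> lderiv x (\<lambda>q. f q - g q) p = lderiv x f p - lderiv x g p"
  unfolding lderiv_def
  by (rule dirderiv_eqI[OF has_derivative_diff[OF has_derivative_dirderiv has_derivative_dirderiv]])

lemma lderiv_const: "lderiv x (\<lambda>q. c) p = 0"
  by (simp add: lderiv_def dirderiv_def)

section \<open>The trivialised differential of a structure-preserving map\<close>

definition ldiff :: "(pt \<Rightarrow> pt) \<Rightarrow> pt \<Rightarrow> pt \<Rightarrow> pt" where
  "ldiff G x p = pm (padj (G p)) (lderiv x G p)"

lemma trless_iff_padj: "x \<in> trless \<longleftrightarrow> x + padj x = 0"
  by (auto simp: trless_def padj_def pt_eq_iff mat2_eq_iff mat2_nth)

lemma padj_pm: "padj (pm x y) = pm (padj y) (padj x)"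
  by (simp add: padj_def pm_def adj2_mult)

text \<open>The curvature of the canonical connection, acting through the bracket.\<close>

definition rho :: "pt \<Rightarrow> pt \<Rightarrow> pt" where
  "rho x y = pb (mu x) (mu y) - mu (pb x y)"

text \<open>Index three of \<open>diff_times\<close> is what \<open>curvature\<close> consumes:
  passing from \<open>G\<close> to \<open>L\<close> costs one, and commuting two derivatives of
  \<open>L\<close> needs index two. The equations are imposed on N only.\<close>

locale nk_map =
  fixes G :: "pt \<Rightarrow> pt" and U :: "pt set" and \<epsilon> :: real
  assumes open_U: "open U" and NN_U: "NN \<subseteq> U" and diff_times_G: "diff_times (Suc (Suc (Suc 0))) U G"
    and G_NN: "\<And>p. p \<in> NN \<Longrightarrow> G p \<in> NN"
    and metric: "\<And>p x y. p \<in> NN \<Longrightarrow> x \<in> trless \<Longrightarrow> y \<in> trless \<Longrightarrow> g0 (ldiff G x p) (ldiff G y p) = g0 x y"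
    and complex: "\<And>p x. p \<in> NN \<Longrightarrow> x \<in> trless \<Longrightarrow> ldiff G (J0 x) p = \<epsilon> *\<^sub>R J0 (ldiff G x p)"
    and sign: "\<epsilon> = 1 \<or> \<epsilon> = -1"
begin

abbreviation L :: "pt \<Rightarrow> pt \<Rightarrow> pt" where "L \<equiv> ldiff G"

lemma diff_times_L: "diff_times (Suc (Suc 0)) U (L x)"
  unfolding ldiff_def
  by (rule diff_times_bilinear[OF open_U pm.bounded_bilinear_axioms
        diff_times_linear[OF open_U linear_padj[unfolded linear_conv_bounded_linear] diff_times_pred[OF diff_times_G]]
        diff_times_lderiv[OF open_U diff_times_G]])

lemmas differentiable_L = diff_times_differentiable[OF diff_times_L]
lemmas differentiable_G = diff_times_differentiable[OF diff_times_G]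
lemmas differentiable_lderiv_L = diff_times_differentiable[OF diff_times_lderiv[OF open_U diff_times_L]]
lemmas differentiable_lderiv_G = diff_times_differentiable[OF diff_times_lderiv[OF open_U diff_times_G]]

lemma linear_L: "p \<in> U \<Longrightarrow> linear (\<lambda>x. L x p)"
  using linear_compose[OF linear_lderiv[OF differentiable_G] bounded_linear.linear[OF pm.bounded_linear_right]]
  by (simp add: ldiff_def o_def)

lemma lderiv_G: "p \<in> NN \<Longrightarrow> lderiv x G p = pm (G p) (L x p)"
  by (simp add: ldiff_def pm_padj_left G_NN)

text \<open>Differentiating \<open>padj G * G = 1\<close> along N gives L + padj L = 0, which for
  pairs of 2 x 2 matrices says that both traces vanish.\<close>

lemma L_trless:
  assumes p: "p \<in> NN" and x: "x \<in> trless" shows "L x p \<in> trless"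
proof -
  have pU: "p \<in> U" using p NN_U by auto
  note padj' = linear_padj[unfolded linear_conv_bounded_linear]
  have d: "(\<lambda>q. padj (G q)) differentiable at p"
    by (intro differentiable_linear_compose[OF padj'] differentiable_G pU)
  have "lderiv x (\<lambda>q. pm (padj (G q)) (G q)) p = lderiv x (\<lambda>q. pone) p"
    by (rule lderiv_tangential[OF _ p x])
       (auto intro!: differentiable_bilinear[OF pm.bounded_bilinear_axioms] d differentiable_G pU simp: pm_padj G_NN)
  also have "lderiv x (\<lambda>q. pm (padj (G q)) (G q)) p = pm (padj (G p)) (lderiv x G p) + pm (padj (lderiv x G p)) (G p)"
    by (simp add: lderiv_bilinear[OF pm.bounded_bilinear_axioms d differentiable_G[OF pU]]
        lderiv_linear_compose[OF linear_padj differentiable_G[OF pU]])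
  also have "\<dots> = L x p + padj (L x p)"
    using G_NN[OF p] by (simp add: lderiv_G p padj_pm pm_assoc pm_padj pm_padj_left)
  finally show ?thesis by (simp add: lderiv_const trless_iff_padj)
qed

lemma lderiv_L_trless:
  assumes p: "p \<in> NN" and x: "x \<in> trless" and y: "y \<in> trless" shows "lderiv y (L x) p \<in> trless"
proof -
  have pU: "p \<in> U" using p NN_U by auto
  have lin: "linear (\<lambda>z. z + padj z)"
    using linear_compose_add[OF linear_ident linear_padj] .
  note lin' = lin[unfolded linear_conv_bounded_linear]
  have "lderiv y (\<lambda>q. L x q + padj (L x q)) p = lderiv y (\<lambda>q. 0) p"
    by (rule lderiv_tangential[OF _ p y])
       (use L_trless[OF _ x] differentiable_linear_compose[OF lin' differentiable_L[OF pU]]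
        in \<open>auto simp: trless_iff_padj\<close>)
  then show ?thesis
    using lderiv_linear_compose[OF lin differentiable_L[OF pU]] by (simp add: lderiv_const trless_iff_padj)
qed

lemma lderiv_metric:
  assumes p: "p \<in> NN" and xyz: "x \<in> trless" "y \<in> trless" "z \<in> trless"
  shows "g0 (lderiv z (L x) p) (L y p) + g0 (L x p) (lderiv z (L y) p) = 0"
proof -
  have pU: "p \<in> U" using p NN_U by auto
  note d = differentiable_L[OF pU]
  have "lderiv z (\<lambda>q. g0 (L x q) (L y q)) p = lderiv z (\<lambda>q. g0 x y) p"
    by (rule lderiv_tangential[OF _ p xyz(3)])
       (auto intro!: differentiable_bilinear[OF g0.bounded_bilinear_axioms] d metric xyz)
  then show ?thesis
    by (simp add: lderiv_bilinear[OF g0.bounded_bilinear_axioms d d] lderiv_const)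
qed

lemma lderiv_complex:
  assumes p: "p \<in> NN" and xy: "x \<in> trless" "y \<in> trless"
  shows "lderiv y (L (J0 x)) p = \<epsilon> *\<^sub>R J0 (lderiv y (L x) p)"
proof -
  have pU: "p \<in> U" using p NN_U by auto
  have lin: "linear (\<lambda>z. \<epsilon> *\<^sub>R J0 z)" using linear_compose_scale_right[OF linear_J0] .
  have "lderiv y (L (J0 x)) p = lderiv y (\<lambda>q. \<epsilon> *\<^sub>R J0 (L x q)) p"
    by (rule lderiv_tangential[OF _ p xy(2)])
       (use differentiable_linear_compose[OF lin[unfolded linear_conv_bounded_linear] differentiable_L[OF pU]]
        in \<open>auto intro!: differentiable_L pU complex xy\<close>)
  then show ?thesis
    using lderiv_linear_compose[OF lin differentiable_L[OF pU]] by simp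
qed

text \<open>The Maurer--Cartan equation for the pull-back of the Maurer--Cartan form by G.\<close>

lemma structure_equation:
  assumes p: "p \<in> NN" and xy: "x \<in> trless" "y \<in> trless"
  shows "lderiv y (L x) p - lderiv x (L y) p = L (pb y x) p - pb (L y p) (L x p)"
proof -
  have pU: "p \<in> U" using p NN_U by auto
  note bil = pm.bounded_bilinear_axioms
  have *: "lderiv y (lderiv x G) p = pm (G p) (lderiv y (L x) p + pm (L y p) (L x p))"
    if xy: "x \<in> trless" "y \<in> trless" for x y
  proof -
    have "lderiv y (lderiv x G) p = lderiv y (\<lambda>q. pm (G q) (L x q)) p"
      by (rule lderiv_tangential[OF _ p xy(2)])
         (use pU in \<open>auto intro!: lderiv_G differentiable_lderiv_G differentiable_bilinear[OF bil]
           differentiable_G differentiable_L\<close>)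
    also have "\<dots> = pm (G p) (lderiv y (L x) p) + pm (pm (G p) (L y p)) (L x p)"
      by (simp add: lderiv_bilinear[OF bil differentiable_G[OF pU] differentiable_L[OF pU]] lderiv_G p)
    finally show ?thesis by (simp add: pm_assoc pm.add_right)
  qed
  from lderiv_commutator[OF open_U diff_times_pred[OF diff_times_G] pU, of y x]
  have "pm (G p) (lderiv y (L x) p + pm (L y p) (L x p) - (lderiv x (L y) p + pm (L x p) (L y p)))
    = pm (G p) (L (pb y x) p)"
    by (simp add: * xy lderiv_G p pm.diff_right)
  then have "lderiv y (L x) p + pm (L y p) (L x p) - (lderiv x (L y) p + pm (L x p) (L y p)) = L (pb y x) p"
    by (metis G_NN p pm_padj_left(2))
  then show ?thesis by (simp add: pb_def algebra_simps)
qed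

text \<open>The Koszul lemma applied at one fixed point, with \<open>b y x\<close> the derivative of
  \<open>L x\<close> in direction y; the preceding lemmas supply its hypotheses.\<close>

lemma
  assumes p: "p \<in> NN" and xy: "x \<in> trless" "y \<in> trless"
  shows parallel: "lderiv y (L x) p = L (pb (mu y) x) p - pb (mu (L y p)) (L x p)"
    and tor_L: "tor (L y p) (L x p) = L (tor y x) p"
proof -
  have pU: "p \<in> U" using p NN_U by auto
  note * = koszul[where L = "\<lambda>x. L x p" and b = "\<lambda>y x. lderiv y (L x) p", OF linear_L[OF pU] L_trless[OF p]
      metric[OF p] complex[OF p] sign lderiv_L_trless[OF p] lderiv_metric[OF p] lderiv_complex[OF p]
      structure_equation[OF p] xy]
  show "lderiv y (L x) p = L (pb (mu y) x) p - pb (mu (L y p)) (L x p)" by (rule *(1))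
  show "tor (L y p) (L x p) = L (tor y x) p" by (rule *(2))
qed

text \<open>\<open>parallel\<close> is differentiated once more along N and skew-symmetrised in z
  and x. The commutator of derivatives is first order, so \<open>parallel\<close> evaluates it too,
  and all derivatives of \<open>L\<close> disappear.\<close>

lemma curvature:
  assumes p: "p \<in> NN" and xyz: "x \<in> trless" "y \<in> trless" "z \<in> trless"
  shows "L (pb (rho z x) y) p = pb (rho (L z p) (L x p)) (L y p)"
proof -
  have pU: "p \<in> U" using p NN_U by auto
  note bil = pb.bounded_bilinear_axioms
  note mu' = linear_mu[unfolded linear_conv_bounded_linear]
  note d = differentiable_L[OF pU] differentiable_linear_compose[OF mu' differentiable_L[OF pU]]
  note lin = linear_add[OF linear_L[OF pU]] linear_diff[OF linear_L[OF pU]]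
  define l where "l x = L x p" for x
  have *: "lderiv z (lderiv x (L y)) p
      = l (pb (mu z) (pb (mu x) y)) - pb (mu (l z)) (l (pb (mu x) y))
      - (pb (mu (l x)) (l (pb (mu z) y) - pb (mu (l z)) (l y)) + pb (mu (l (pb (mu z) x) - pb (mu (l z)) (l x))) (l y))"
    if xyz: "x \<in> trless" "y \<in> trless" "z \<in> trless" for x y z
  proof -
    have "lderiv z (lderiv x (L y)) p = lderiv z (\<lambda>q. L (pb (mu x) y) q - pb (mu (L x q)) (L y q)) p"
      by (rule lderiv_tangential[OF _ p xyz(3)])
         (use pU xyz in \<open>auto intro!: parallel differentiable_lderiv_L derivative_intros
           differentiable_bilinear[OF bil] d\<close>)
    also have "\<dots> = lderiv z (L (pb (mu x) y)) p - (pb (mu (L x p)) (lderiv z (L y) p) + pb (mu (lderiv z (L x) p)) (L y p))"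
      using differentiable_bilinear[OF bil d(2) d(1)]
      by (simp add: lderiv_diff d lderiv_bilinear[OF bil d(2) d(1)] lderiv_linear_compose[OF linear_mu d(1)])
    finally show ?thesis using xyz by (simp add: parallel p pb_trless l_def)
  qed
  have 1: "lderiv z (lderiv x (L y)) p - lderiv x (lderiv z (L y)) p
      = l (pb (mu (pb z x)) y) - pb (mu (l (pb z x))) (l y)"
    using lderiv_commutator[OF open_U diff_times_L pU, of z x y] xyz by (simp add: parallel p pb_trless l_def)
  have jac: "pb (mu u) (pb (mu v) w) - pb (mu v) (pb (mu u) w) = pb (pb (mu u) (mu v)) w" for u v w
    using pb_jacobi[of "mu u" "mu v" w] by simp
  have T: "tor (l z) (l x) = l (tor z x)" unfolding l_def by (rule tor_L[OF p xyz(1,3)])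
  have T': "l (pb (mu z) x) - l (pb (mu x) z) - l (pb z x) = l (tor z x)"
    unfolding l_def tor_def by (simp add: lin)
  have "l (pb (mu z) (pb (mu x) y)) - l (pb (mu x) (pb (mu z) y)) = l (pb (pb (mu z) (mu x)) y)"
    using jac[of z x y] unfolding l_def by (simp flip: lin)
  moreover have "pb (mu (l x)) (pb (mu (l z)) (l y)) - pb (mu (l z)) (pb (mu (l x)) (l y)) = pb (pb (mu (l x)) (mu (l z))) (l y)"
    by (rule jac)
  \<comment> \<open>Here torsion invariance enters: it turns the skew part of the derivative of
    \<open>L\<close> into the bracket defect l [z,x] - [l z, l x].\<close>
  moreover have "pb (mu (l (pb (mu z) x) - pb (mu (l z)) (l x))) (l y) - pb (mu (l (pb (mu x) z) - pb (mu (l x)) (l z))) (l y)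
     = pb (mu (l (pb z x) - pb (l z) (l x))) (l y)"
  proof -
    have "(l (pb (mu z) x) - pb (mu (l z)) (l x)) - (l (pb (mu x) z) - pb (mu (l x)) (l z)) = l (pb z x) - pb (l z) (l x)"
      using T T' unfolding tor_def by (simp add: algebra_simps)
    then show ?thesis by (simp flip: pb.diff_left mu_linear)
  qed
  ultimately have "l (pb (pb (mu z) (mu x)) y) - l (pb (mu (pb z x)) y)
     = pb (mu (l (pb z x) - pb (l z) (l x))) (l y) - pb (mu (l (pb z x))) (l y) - pb (pb (mu (l x)) (mu (l z))) (l y)"
    using 1 unfolding *[OF xyz] *[OF xyz(3,2,1)] by (simp add: pb.diff_right algebra_simps)
  then have "l (pb (rho z x) y) = pb (pb (mu (l z)) (mu (l x)) - mu (pb (l z) (l x))) (l y)"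
    unfolding rho_def l_def
    by (simp add: pb.diff_left lin mu_linear pb_skew[of "mu (L x p)" "mu (L z p)"] pb.minus_left)
  then show ?thesis by (simp add: rho_def l_def)
qed

end

section \<open>Automorphisms of the Lie algebra of traceless matrices\<close>

definition mh :: mat2 where "mh = vector [vector [1, 0], vector [0, -1]]"
definition me :: mat2 where "me = vector [vector [0, 1], vector [0, 0]]"
definition mf :: mat2 where "mf = vector [vector [0, 0], vector [1, 0]]"

abbreviation mb :: "mat2 \<Rightarrow> mat2 \<Rightarrow> mat2" where "mb a b \<equiv> a ** b - b ** a"

lemma trace_mh_me_mf: "trace mh = 0" "trace me = 0" "trace mf = 0"
  by (simp_all add: mh_def me_def mf_def trace2)

lemma mb_mh_me_mf: "mb mh me = 2 *\<^sub>R me" "mb mh mf = (-2) *\<^sub>R mf" "mb me mf = mh"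
  by (simp_all add: mh_def me_def mf_def mat2_eq_iff mat2_nth)

lemma traceless_expand:
  "trace a = 0 \<Longrightarrow> a = a$1$1 *\<^sub>R mh + a$1$2 *\<^sub>R me + a$2$1 *\<^sub>R mf"
  by (simp add: mh_def me_def mf_def mat2_eq_iff trace2)

lemma trace_mb: "trace (mb a b) = 0"
  by (simp add: mat2_nth)

text \<open>Polarised Cayley-Hamilton identity: the square of a traceless 2 x 2 matrix is
  scalar.\<close>

lemma traceless_mult_add:
  assumes "trace (a::mat2) = 0" "trace b = 0"
  shows "a ** b + b ** a = trace (a ** b) *\<^sub>R mat 1"
proof -
  have "a$2$2 = - a$1$1" "b$2$2 = - b$1$1" using assms by (simp_all add: trace2)
  then show ?thesis by (simp add: mat2_eq_iff mat2_nth)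
qed

lemma traceless_commute:
  assumes "trace a = 0" "trace b = 0" "a \<noteq> 0" "mb a b = (0::mat2)"
  shows "\<exists>r. b = r *\<^sub>R a"
proof -
  have 2: "a$2$2 = - a$1$1" "b$2$2 = - b$1$1" using assms(1,2) by (simp_all add: trace2)
  have e: "a$1$2 * b$2$1 = a$2$1 * b$1$2" "a$1$1 * b$1$2 = a$1$2 * b$1$1" "a$1$1 * b$2$1 = a$2$1 * b$1$1"
    using arg_cong[OF assms(4), of "\<lambda>m. m$1$1"] arg_cong[OF assms(4), of "\<lambda>m. m$1$2"]
      arg_cong[OF assms(4), of "\<lambda>m. m$2$1"]
    unfolding vector_minus_component mat2_mult_nth zero_index 2 by algebra+
  have q: "x *\<^sub>R b = y *\<^sub>R a" if "x * b$1$1 = y * a$1$1" "x * b$1$2 = y * a$1$2" "x * b$2$1 = y * a$2$1" for x y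
    using that by (simp add: mat2_eq_iff 2)
  have p1: "a$1$1 *\<^sub>R b = b$1$1 *\<^sub>R a" by (rule q; use e in \<open>simp add: mult.commute\<close>)
  have p2: "a$1$2 *\<^sub>R b = b$1$2 *\<^sub>R a" by (rule q; use e in \<open>simp add: mult.commute\<close>)
  have p3: "a$2$1 *\<^sub>R b = b$2$1 *\<^sub>R a" by (rule q; use e in \<open>simp add: mult.commute\<close>)
  have "b = (y / x) *\<^sub>R a" if "x *\<^sub>R b = y *\<^sub>R a" "x \<noteq> 0" for x y :: real
  proof -
    have "b = (1 / x) *\<^sub>R (x *\<^sub>R b)" using that(2) by simp
    also have "\<dots> = (y / x) *\<^sub>R a" unfolding that(1) by simp
    finally show ?thesis .
  qed
  moreover have "a$1$1 \<noteq> 0 \<or> a$1$2 \<noteq> 0 \<or> a$2$1 \<noteq> 0"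
    using assms(3) 2 by (auto simp: mat2_eq_iff)
  ultimately show ?thesis using p1 p2 p3 by blast
qed

lemma mat2_mult_scale_diff:
  fixes A B C :: mat2
  shows "A ** (B + C) = A ** B + A ** C" "(A + B) ** C = A ** C + B ** C"
    "A ** (B - C) = A ** B - A ** C" "(A - B) ** C = A ** C - B ** C"
    "A ** (- B) = - (A ** B)" "(- A) ** B = - (A ** B)"
  by (simp_all add: mat2_eq_iff mat2_nth algebra_simps)

lemmas mat2_ring = mat2_mult_scale_diff mat2_mult_scaleR matrix_mul_assoc

text \<open>In the basis \<open>i, j, k\<close> a Lie algebra automorphism preserves the quaternion relations, so
  averaging \<open>y\<close> over the quaternion group gives an intertwiner \<open>c\<close>.\<close>

lemma quaternion_intertwiner:
  fixes I J K :: mat2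
  assumes tr: "trace I = 0" "trace J = 0" "trace K = 0"
    and br: "mb I J = 2 *\<^sub>R K" "mb J K = (-2) *\<^sub>R I" "mb K I = (-2) *\<^sub>R J" and nz: "J \<noteq> 0" "I \<noteq> 0"
  shows "\<exists>c. c \<noteq> 0 \<and> I ** c = c ** mh \<and> J ** c = c ** (me + mf)"
proof -
  define i j k where "i = mh" and "j = me + mf" and "k = me - mf"
  \<comment> \<open>These traces show that I, J, K are pairwise orthogonal for the trace form, hence
    anticommute by \<open>traceless_mult_add\<close>; the commutator relations then determine the
    products themselves.\<close>
  have trc: "trace (A ** mb A B) = 0" "trace (B ** mb A B) = 0" for A B :: mat2
    by (simp_all add: mat2_nth algebra_simps)
  have trs: "trace (A ** (r *\<^sub>R B)) = r * trace (A ** B)" for r and A B :: mat2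
    by (simp add: trace2 mat2_mult_scaleR algebra_simps)
  have "trace (I ** K) = 0" "trace (J ** K) = 0"
    using trc(1)[of I J] trc(2)[of J I] unfolding br trs by auto
  moreover have "trace (K ** J) = 0" "trace (I ** J) = 0"
    using trc(1)[of K I] trc(2)[of I K] unfolding br trs by auto
  moreover have "trace (K ** I) = trace (I ** K)" by (simp add: mat2_nth)
  ultimately have "trace (I ** J) = 0" "trace (J ** K) = 0" "trace (K ** I) = 0" by auto
  then have anti: "I ** J + J ** I = 0" "J ** K + K ** J = 0" "K ** I + I ** K = 0"
    using traceless_mult_add tr by simp_all
  have half: "A = B" if "A - A' = 2 *\<^sub>R B" "A + A' = 0" for A A' B :: mat2
  proof -
    have "2 *\<^sub>R A = (A - A') + (A + A')" by (simp add: scaleR_2)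
    then show ?thesis using that by simp
  qed
  have prods: "I ** J = K" "J ** K = - I" "K ** I = - J"
    using half[OF br(1) anti(1)] half[of "J ** K" "K ** J" "- I"] half[of "K ** I" "I ** K" "- J"] br anti by simp_all
  have prods': "J ** I = - K" "K ** J = I" "I ** K = J"
    using anti prods by (simp_all add: eq_neg_iff_add_eq_0 add.commute)
  obtain s t where s: "I ** I = s *\<^sub>R mat 1" and t: "J ** J = t *\<^sub>R mat 1"
  proof -
    have "A ** A = (trace (A ** A) / 2) *\<^sub>R mat 1" if "trace A = 0" for A :: mat2
    proof -
      have "A$2$2 = - A$1$1" using that by (simp add: trace2)
      then show ?thesis by (simp add: mat2_eq_iff mat2_nth)
    qed
    then show ?thesis using that tr by blast
  qed
  have "s *\<^sub>R J = (I ** I) ** J" by (simp add: s mat2_ring)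
  also have "\<dots> = J" using prods prods' by (simp flip: matrix_mul_assoc)
  finally have "(s - 1) *\<^sub>R J = 0" by (simp add: scaleR_diff_left)
  then have II: "I ** I = mat 1" using nz s by simp
  have "t *\<^sub>R I = (J ** J) ** I" by (simp add: t mat2_ring)
  also have "\<dots> = I" using prods prods' by (simp add: mat2_ring flip: matrix_mul_assoc)
  finally have "(t - 1) *\<^sub>R I = 0" by (simp add: scaleR_diff_left)
  then have JJ: "J ** J = mat 1" using nz t by simp
  \<comment> \<open>Each summand is a unit times y times the inverse of the matching standard unit.
    As i and j square to 1 but k to -1, the inverse of k is -k, whence the minus sign.\<close>
  define c where "c y = y + I ** y ** i + J ** y ** j - K ** y ** k" for y
  have ijk: "i ** i = mat 1" "j ** j = mat 1" "j ** i = - k" "k ** i = - j" "i ** j = k" "k ** j = i"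
    by (simp_all add: i_def j_def k_def mh_def me_def mf_def mat2_eq_iff mat2_nth)
  have Ic: "I ** c y = c y ** i" for y
  proof -
    have "I ** c y = I ** y + (I ** I) ** y ** i + (I ** J) ** y ** j - (I ** K) ** y ** k"
      by (simp add: c_def mat2_ring)
    moreover have "c y ** i = y ** i + I ** y ** (i ** i) + J ** y ** (j ** i) - K ** y ** (k ** i)"
      by (simp add: c_def mat2_ring)
    ultimately show ?thesis by (simp add: II prods prods' ijk mat2_ring)
  qed
  have Jc: "J ** c y = c y ** j" for y
  proof -
    have "J ** c y = J ** y + (J ** I) ** y ** i + (J ** J) ** y ** j - (J ** K) ** y ** k"
      by (simp add: c_def mat2_ring)
    moreover have "c y ** j = y ** j + I ** y ** (i ** j) + J ** y ** (j ** j) - K ** y ** (k ** j)"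
      by (simp add: c_def mat2_ring)
    ultimately show ?thesis by (simp add: JJ prods prods' ijk mat2_ring)
  qed
  \<comment> \<open>Not both averages vanish: the two computed entries add up to 2.\<close>
  define y1 y2 :: mat2 where "y1 = vector [vector [1, 0], vector [0, 0]]" and "y2 = vector [vector [0, 1], vector [0, 0]]"
  have "c y1 $ 1 $ 1 = 1 + I$1$1" "c y2 $ 1 $ 2 = 1 - I$1$1"
    by (simp_all add: c_def y1_def y2_def i_def j_def k_def mh_def me_def mf_def mat2_nth)
  then have "c y1 \<noteq> 0 \<or> c y2 \<noteq> 0" by (auto simp: mat2_eq_iff)
  then show ?thesis using Ic Jc unfolding i_def j_def by blast
qed

text \<open>For singular c and b = adj c the product c m b vanishes for m = 1, mh, me + mf and mh
  (me + mf). These span all matrices, so every entry of c times every entry of b is zero, although b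
  has the entries of c up to sign.\<close>

lemma intertwiner_invertible:
  fixes c I J :: mat2
  assumes "c \<noteq> 0" "I ** c = c ** mh" "J ** c = c ** (me + mf)"
  shows "det c \<noteq> 0"
proof
  assume "det c = 0"
  define b where "b = adj2 c"
  have cb: "c ** b = 0" using mult_adj2(1)[of c] \<open>det c = 0\<close> mat_eq_scaleR[of 0] by (simp add: b_def)
  have z: "a ** 0 = 0" for a :: mat2 by (simp add: mat2_eq_iff mat2_nth)
  have "c ** mh ** b = 0" "c ** (me + mf) ** b = 0"
    using cb z by (simp_all flip: assms(2,3) matrix_mul_assoc)
  moreover have "c ** mh ** (me + mf) ** b = 0"
    unfolding assms(2)[symmetric] using \<open>c ** (me + mf) ** b = 0\<close> z by (simp flip: matrix_mul_assoc)
  ultimately have "c$1$1 * b$1$1 = 0" "c$1$2 * b$2$1 = 0" "c$1$1 * b$1$2 = 0" "c$1$1 * b$2$2 = 0"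
      "c$1$1 * b$2$1 = 0" "c$1$2 * b$1$1 = 0" "c$2$1 * b$1$1 = 0" "c$2$2 * b$1$1 = 0"
      "c$2$1 * b$2$2 = 0" "c$2$2 * b$2$2 = 0" "c$1$2 * b$1$2 = 0" "c$2$1 * b$2$1 = 0"
    using cb by (auto simp: mat2_eq_iff mat2_nth mh_def me_def mf_def algebra_simps)
  then show False using \<open>c \<noteq> 0\<close> by (auto simp: b_def mat2_eq_iff adj2_nth)
qed

text \<open>Over the reals scaling c changes det c by a square, so its sign persists; this is why
  determinant -1 occurs. With determinant \<plusminus>1 the inverse of c is
  \<open>det c *\<^sub>R adj2 c\<close>.\<close>

lemma sl2_automorphism:
  fixes \<theta> :: "mat2 \<Rightarrow> mat2"
  assumes lin: "\<And>a b r. trace a = 0 \<Longrightarrow> trace b = 0 \<Longrightarrow> \<theta> (a + b) = \<theta> a + \<theta> b"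
      "\<And>a r. trace a = 0 \<Longrightarrow> \<theta> (r *\<^sub>R a) = r *\<^sub>R \<theta> a"
    and tr: "\<And>a. trace a = 0 \<Longrightarrow> trace (\<theta> a) = 0"
    and br: "\<And>a b. trace a = 0 \<Longrightarrow> trace b = 0 \<Longrightarrow> \<theta> (mb a b) = mb (\<theta> a) (\<theta> b)"
    and inj: "\<And>a. trace a = 0 \<Longrightarrow> \<theta> a = 0 \<Longrightarrow> a = 0"
  shows "\<exists>c. (det c = 1 \<or> det c = -1) \<and> (\<forall>a. trace a = 0 \<longrightarrow> \<theta> a = det c *\<^sub>R (c ** a ** adj2 c))"
proof -
  have tr3: "trace (me + mf) = 0" "trace (me - mf) = 0" by (simp_all add: me_def mf_def trace2)
  have nz: "mh \<noteq> 0" "me + mf \<noteq> 0" by (simp_all add: mh_def me_def mf_def mat2_eq_iff)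
  have b3: "mb mh (me + mf) = 2 *\<^sub>R (me - mf)" "mb (me + mf) (me - mf) = (-2) *\<^sub>R mh"
    "mb (me - mf) mh = (-2) *\<^sub>R (me + mf)"
    by (simp_all add: mh_def me_def mf_def mat2_eq_iff mat2_nth)
  note t = trace_mh_me_mf tr3
  have br3: "mb (\<theta> mh) (\<theta> (me + mf)) = 2 *\<^sub>R \<theta> (me - mf)"
    "mb (\<theta> (me + mf)) (\<theta> (me - mf)) = (-2) *\<^sub>R \<theta> mh" "mb (\<theta> (me - mf)) (\<theta> mh) = (-2) *\<^sub>R \<theta> (me + mf)"
    unfolding lin(2)[OF t(1), symmetric] lin(2)[OF t(4), symmetric] lin(2)[OF t(5), symmetric] b3[symmetric]
    by (simp_all only: br t)
  have "\<theta> mh \<noteq> 0" "\<theta> (me + mf) \<noteq> 0" using nz inj t by blast+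
  then have "\<exists>c. c \<noteq> 0 \<and> \<theta> mh ** c = c ** mh \<and> \<theta> (me + mf) ** c = c ** (me + mf)"
    by (intro quaternion_intertwiner[where K = "\<theta> (me - mf)"] br3 tr t)
  then obtain c where c: "c \<noteq> 0" "\<theta> mh ** c = c ** mh" "\<theta> (me + mf) ** c = c ** (me + mf)" by blast
  have dc: "det c \<noteq> 0" by (rule intertwiner_invertible[OF c])
  have k: "\<theta> (me - mf) ** c = c ** (me - mf)"
  proof -
    have "2 *\<^sub>R (\<theta> (me - mf) ** c) = \<theta> mh ** (\<theta> (me + mf) ** c) - \<theta> (me + mf) ** (\<theta> mh ** c)"
      by (simp only: br3(1)[symmetric] mat2_mult_scaleR(1)[symmetric] mat2_mult_scale_diff(4) matrix_mul_assoc)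
    also have "\<dots> = (\<theta> mh ** c) ** (me + mf) - (\<theta> (me + mf) ** c) ** mh"
      by (simp only: c(2,3) matrix_mul_assoc)
    also have "\<dots> = c ** mb mh (me + mf)"
      by (simp only: c(2,3) matrix_mul_assoc mat2_mult_scale_diff)
    also have "\<dots> = 2 *\<^sub>R (c ** (me - mf))" unfolding b3 by (simp add: mat2_mult_scaleR)
    finally show ?thesis by simp
  qed
  have int: "\<theta> a ** c = c ** a" if "trace a = 0" for a
  proof -
    define x y z where "x = a$1$1" and "y = (a$1$2 + a$2$1) / 2" and "z = (a$1$2 - a$2$1) / 2"
    have a: "a = x *\<^sub>R mh + y *\<^sub>R (me + mf) + z *\<^sub>R (me - mf)"
      using that by (simp add: x_def y_def z_def mh_def me_def mf_def mat2_eq_iff trace2 field_simps)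
    have trs: "trace (r *\<^sub>R m) = 0" if "trace m = 0" for r and m :: mat2
      using that by (simp add: trace2 flip: distrib_left)
    have tra: "trace (m + n) = 0" if "trace m = 0" "trace n = 0" for m n :: mat2
      using that by (simp add: trace2)
    have "\<theta> a = x *\<^sub>R \<theta> mh + y *\<^sub>R \<theta> (me + mf) + z *\<^sub>R \<theta> (me - mf)"
      unfolding a using t by (simp only: lin trs tra)
    then have "\<theta> a ** c = x *\<^sub>R (\<theta> mh ** c) + y *\<^sub>R (\<theta> (me + mf) ** c) + z *\<^sub>R (\<theta> (me - mf) ** c)"
      by (simp only: mat2_mult_scale_diff mat2_mult_scaleR)
    also have "\<dots> = c ** a"
      unfolding c k using arg_cong[OF a, of "\<lambda>m. c ** m"] by (simp only: mat2_mult_scale_diff mat2_mult_scaleR)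
    finally show ?thesis .
  qed
  define s where "s = 1 / sqrt \<bar>det c\<bar>"
  have ss: "s * s * \<bar>det c\<bar> = 1" using dc by (simp add: s_def field_simps)
  have det: "det (s *\<^sub>R c) = s * s * det c" by (simp add: det_2 algebra_simps)
  then have d1: "det (s *\<^sub>R c) = 1 \<or> det (s *\<^sub>R c) = -1"
    using ss by (cases "det c > 0") (auto simp: abs_if split: if_splits)
  have "\<theta> a = det (s *\<^sub>R c) *\<^sub>R ((s *\<^sub>R c) ** a ** adj2 (s *\<^sub>R c))" if "trace a = 0" for a
  proof -
    define e where "e = s *\<^sub>R c"
    have "e ** a = \<theta> a ** e" using int[OF that] by (simp add: e_def mat2_mult_scaleR)
    then have "e ** a ** adj2 e = \<theta> a ** (e ** adj2 e)" by (simp add: matrix_mul_assoc)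
    also have "\<dots> = det e *\<^sub>R \<theta> a" by (simp add: mult_adj2 mat_eq_scaleR[of "det e"] mat2_mult_scaleR)
    finally show ?thesis using d1 unfolding e_def[symmetric] by auto
  qed
  with d1 show ?thesis by blast
qed

text \<open>f mh commutes with \<theta> mh, hence is a multiple of it; equivariance carries the
  factor over to me and mf, which are brackets with mh.\<close>

lemma sl2_schur:
  fixes f \<theta> :: "mat2 \<Rightarrow> mat2"
  assumes lin: "linear f" and tr: "\<And>a. trace a = 0 \<Longrightarrow> trace (f a) = 0"
    and \<theta>: "\<And>a b r. trace a = 0 \<Longrightarrow> trace b = 0 \<Longrightarrow> \<theta> (a + b) = \<theta> a + \<theta> b"
      "\<And>a r. trace a = 0 \<Longrightarrow> \<theta> (r *\<^sub>R a) = r *\<^sub>R \<theta> a"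
      "\<And>a. trace a = 0 \<Longrightarrow> trace (\<theta> a) = 0"
      "\<And>a b. trace a = 0 \<Longrightarrow> trace b = 0 \<Longrightarrow> \<theta> (mb a b) = mb (\<theta> a) (\<theta> b)"
      "\<And>a. trace a = 0 \<Longrightarrow> \<theta> a = 0 \<Longrightarrow> a = 0"
    and eq: "\<And>a b. trace a = 0 \<Longrightarrow> trace b = 0 \<Longrightarrow> f (mb a b) = mb (\<theta> a) (f b)"
  shows "\<exists>r. \<forall>a. trace a = 0 \<longrightarrow> f a = r *\<^sub>R \<theta> a"
proof -
  note t = trace_mh_me_mf
  have "mh \<noteq> 0" by (simp add: mh_def mat2_eq_iff)
  then have "\<theta> mh \<noteq> 0" using \<theta>(5) t by blast
  moreover have "mb (\<theta> mh) (f mh) = 0" using eq[of mh mh] t linear_0[OF lin] by simp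
  ultimately obtain r where r: "f mh = r *\<^sub>R \<theta> mh"
    using traceless_commute[of "\<theta> mh" "f mh"] \<theta>(3) tr t by blast
  have *: "f (mb a mh) = r *\<^sub>R \<theta> (mb a mh)" if "trace a = 0" for a
    using that t by (simp add: eq \<theta>(4) r mat2_mult_scaleR scaleR_diff_right)
  have bb: "mb ((-1/2) *\<^sub>R me) mh = me" "mb ((1/2) *\<^sub>R mf) mh = mf"
    by (simp_all add: mh_def me_def mf_def mat2_eq_iff mat2_nth)
  have trs: "trace (r *\<^sub>R m) = 0" if "trace m = 0" for r and m :: mat2
    using that by (simp add: trace2 flip: distrib_left)
  have tra: "trace (m + n) = 0" if "trace m = 0" "trace n = 0" for m n :: mat2
    using that by (simp add: trace2)
  have "f me = r *\<^sub>R \<theta> me" "f mf = r *\<^sub>R \<theta> mf"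
    using *[OF trs[OF t(2), of "-1/2"]] *[OF trs[OF t(3), of "1/2"]] unfolding bb by blast+
  then have "f a = r *\<^sub>R \<theta> a" if "trace a = 0" for a
  proof -
    have "f (x *\<^sub>R mh + y *\<^sub>R me + z *\<^sub>R mf) = r *\<^sub>R \<theta> (x *\<^sub>R mh + y *\<^sub>R me + z *\<^sub>R mf)" for x y z
      using t \<open>f me = _\<close> \<open>f mf = _\<close> r
      by (simp add: linear_add[OF lin] linear_scale[OF lin] \<theta>(1,2) trs tra scaleR_add_right mult.commute)
    then show ?thesis using traceless_expand[OF that] by metis
  qed
  then show ?thesis by blast
qed

section \<open>Linear isometries preserving torsion and curvature\<close>

definition pick3 :: "nat \<Rightarrow> 'a \<Rightarrow> 'a \<Rightarrow> 'a \<Rightarrow> 'a" where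
  "pick3 i x y z = (if i = 0 then x else if i = 1 then y else z)"

text \<open>The three factors of \<open>G^3\<close> are numbered 0, 1, 2; the tangent vector \<open>(\<alpha>, \<beta>)\<close> of N lifts to
  \<open>(\<alpha>, \<beta>, 0)\<close>, and \<open>tri i j k\<close> is the action of a permutation of the factors.\<close>

definition tri :: "nat \<Rightarrow> nat \<Rightarrow> nat \<Rightarrow> pt \<Rightarrow> pt" where
  "tri i j k x = (pick3 i (fst x) (snd x) 0 - pick3 k (fst x) (snd x) 0,
                  pick3 j (fst x) (snd x) 0 - pick3 k (fst x) (snd x) 0)"

definition conjp :: "mat2 \<Rightarrow> pt \<Rightarrow> pt" where
  "conjp c x = det c *\<^sub>R (c ** fst x ** adj2 c, c ** snd x ** adj2 c)"

definition perms3 :: "(nat \<times> nat \<times> nat) set" where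
  "perms3 = {(0, 1, 2), (1, 0, 2), (0, 2, 1), (2, 1, 0), (1, 2, 0), (2, 0, 1)}"

lemma pb_diag: "pb (a, a) y = (mb a (fst y), mb a (snd y))"
  by (simp add: pb_def pm_def)

lemma rho_diag: "\<exists>r. trace r = 0 \<and> rho x y = (r, r)"
proof -
  define m n where "m = fst (mu x)" and "n = fst (mu y)"
  define r where "r = mb m n - fst (mu (pb x y))"
  have "mu x = (m, m)" "mu y = (n, n)" "mu (pb x y) = (fst (mu (pb x y)), fst (mu (pb x y)))"
    by (simp_all add: mu_def m_def n_def)
  then have "rho x y = pb (m, m) (n, n) - (fst (mu (pb x y)), fst (mu (pb x y)))"
    unfolding rho_def by simp
  then have "rho x y = (r, r)" by (simp add: pb_diag r_def)
  moreover have "trace r = 0"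
    using trless_closed(1)[OF pb_trless[of x y]] trace_mb[of m n] by (simp add: r_def trless_def trace_sub)
  ultimately show ?thesis by blast
qed

text \<open>The constant is 1/9 - 1/3. Being nonzero, it makes the curvature operators fill the
  whole diagonal copy of ad sl(2).\<close>

lemma rho_first_factor: "rho (a, 0) (b, 0) = (-2/9) *\<^sub>R (mb a b, mb a b)"
proof -
  have "mu (m, 0) = (1/3) *\<^sub>R (m, m)" for m by (simp add: mu_def)
  moreover have "pb (a, 0) (b, 0) = (mb a b, 0)" by (simp add: pb_def pm_def mat2_eq_iff mat2_nth)
  ultimately have "rho (a, 0) (b, 0) = (1/9) *\<^sub>R pb (a, a) (b, b) - (1/3) *\<^sub>R (mb a b, mb a b)"
    unfolding rho_def by (simp only: pb.scaleR_left pb.scaleR_right) simp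
  also have "\<dots> = (1/9 - 1/3) *\<^sub>R (mb a b, mb a b)"
    unfolding scaleR_left_diff_distrib by (simp add: pb_diag)
  finally show ?thesis by simp
qed

lemma trace_scaleR_add:
  fixes a b :: mat2
  shows "trace a = 0 \<Longrightarrow> trace (r *\<^sub>R a) = 0"
    "trace a = 0 \<Longrightarrow> trace b = 0 \<Longrightarrow> trace (a + b) = 0"
  by (simp_all add: trace2 flip: distrib_left)

lemma traceless_centralizer:
  assumes "trace a = 0" "\<And>w. w \<in> trless \<Longrightarrow> pb (a, a) w = 0"
  shows "a = 0"
proof -
  have "(mh, 0) \<in> trless" "(me, 0) \<in> trless" by (simp_all add: trless_def trace_mh_me_mf trace2[of 0])
  then have "mb a mh = 0" "mb a me = 0" using assms(2) by (auto simp: pb_diag zero_prod_def)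
  then show ?thesis using assms(1) by (simp add: mat2_eq_iff mat2_nth mh_def me_def)
qed

text \<open>The property is linear in a and holds for brackets because they are curvature values, up
  to the factor -2/9; sl(2) is spanned by brackets.\<close>

lemma curvature_normalizer:
  fixes l :: "pt \<Rightarrow> pt"
  assumes lin: "linear l"
    and curv: "\<And>x y z. x \<in> trless \<Longrightarrow> y \<in> trless \<Longrightarrow> z \<in> trless \<Longrightarrow> l (pb (rho z x) y) = pb (rho (l z) (l x)) (l y)"
    and a: "trace a = 0"
  shows "\<exists>a'. trace a' = 0 \<and> (\<forall>y\<in>trless. l (pb (a, a) y) = pb (a', a') (l y))"
proof -
  define P where "P a \<longleftrightarrow> (\<exists>a'. trace a' = 0 \<and> (\<forall>y\<in>trless. l (pb (a, a) y) = pb (a', a') (l y)))" for a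
  have diag: "(r *\<^sub>R a, r *\<^sub>R a) = r *\<^sub>R (a, a)" "(a + b, a + b) = (a, a) + (b, b)" for r and a b :: mat2
    by simp_all
  have scale: "P (r *\<^sub>R a)" if "P a" for r a
  proof -
    obtain a' where a': "trace a' = 0" "\<And>y. y \<in> trless \<Longrightarrow> l (pb (a, a) y) = pb (a', a') (l y)"
      using \<open>P a\<close> unfolding P_def by blast
    have "l (pb (r *\<^sub>R a, r *\<^sub>R a) y) = pb (r *\<^sub>R a', r *\<^sub>R a') (l y)" if "y \<in> trless" for y
      unfolding diag pb.scaleR_left linear_scale[OF lin] a'(2)[OF that] ..
    then show ?thesis unfolding P_def using trace_scaleR_add(1)[OF a'(1)] by blast
  qed
  have add: "P (a + b)" if "P a" "P b" for a b
  proof -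
    obtain a' b' where a': "trace a' = 0" "\<And>y. y \<in> trless \<Longrightarrow> l (pb (a, a) y) = pb (a', a') (l y)"
      and b': "trace b' = 0" "\<And>y. y \<in> trless \<Longrightarrow> l (pb (b, b) y) = pb (b', b') (l y)"
      using \<open>P a\<close> \<open>P b\<close> unfolding P_def by blast
    have "l (pb (a + b, a + b) y) = pb (a' + b', a' + b') (l y)" if "y \<in> trless" for y
      unfolding diag pb.add_left linear_add[OF lin] a'(2)[OF that] b'(2)[OF that] ..
    then show ?thesis unfolding P_def using trace_scaleR_add(2)[OF a'(1) b'(1)] by blast
  qed
  have br: "P (mb a b)" if "trace a = 0" "trace b = 0" for a b
  proof -
    obtain r where r: "trace r = 0" "rho (l (a, 0)) (l (b, 0)) = (r, r)" using rho_diag by blast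
    have in0: "(a, 0) \<in> trless" "(b, 0) \<in> trless" using that by (simp_all add: trless_def trace2[of 0])
    have "l (pb ((-2/9) *\<^sub>R mb a b, (-2/9) *\<^sub>R mb a b) y) = pb (r, r) (l y)" if "y \<in> trless" for y
      unfolding diag rho_first_factor[symmetric] curv[OF in0(2) that in0(1)] r(2) ..
    then have "P ((-2/9) *\<^sub>R mb a b)" unfolding P_def using r(1) by blast
    from scale[OF this, of "-9/2"] show ?thesis by simp
  qed
  have "mb ((1/2) *\<^sub>R mh) me = me" "mb ((-1/2) *\<^sub>R mh) mf = mf"
    by (simp_all add: mh_def me_def mf_def mat2_eq_iff mat2_nth)
  then have "P mh" "P me" "P mf"
    using br[OF trace_mh_me_mf(2,3)] br[OF trace_scaleR_add(1)[OF trace_mh_me_mf(1)] trace_mh_me_mf(2), of "1/2"]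
      br[OF trace_scaleR_add(1)[OF trace_mh_me_mf(1)] trace_mh_me_mf(3), of "-1/2"]
    unfolding mb_mh_me_mf(3) by auto
  then have "P (x *\<^sub>R mh + y *\<^sub>R me + z *\<^sub>R mf)" for x y z by (intro add scale)
  then have "P a" using traceless_expand[OF a] by metis
  then show ?thesis unfolding P_def .
qed

text \<open>The columns (r, t) and (s, u) are the images of the first two factors. Each must be
  (1,0), (0,1) or (-1,-1), the classes of the three unit vectors modulo (1,1,1); the mixed equations
  forbid equal columns.\<close>

lemma tri_coefficients:
  fixes r s t u :: real
  assumes "t * r + r * t - r * r = - r" "r * t + t * r - t * t = - t"
    and "u * s + s * u - s * s = - s" "s * u + u * s - u * u = - u"
    and "t * s + r * u - r * s = r + s" "r * u + t * s - t * u = t + u"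
    and "r \<noteq> 0 \<or> t \<noteq> 0" "s \<noteq> 0 \<or> u \<noteq> 0"
  shows "(r, t, s, u) \<in> {(1,0,0,1), (0,1,1,0), (1,0,-1,-1), (-1,-1,0,1), (0,1,-1,-1), (-1,-1,1,0)}"
proof -
  have *: "(r = 1 \<and> t = 0) \<or> (r = 0 \<and> t = 1) \<or> (r = -1 \<and> t = -1)"
    if "t * r + r * t - r * r = - r" "r * t + t * r - t * t = - t" "r \<noteq> 0 \<or> t \<noteq> 0" for r t :: real
  proof -
    have "r * (2 * t - r + 1) = (t * r + r * t - r * r) + r" "t * (2 * r - t + 1) = (r * t + t * r - t * t) + t"
      by (simp_all add: algebra_simps)
    then have "r = 0 \<or> 2 * t - r + 1 = 0" "t = 0 \<or> 2 * r - t + 1 = 0"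
      unfolding that(1,2) by simp_all
    then show ?thesis using that(3) by auto
  qed
  show ?thesis using *[OF assms(1,2,7)] *[OF assms(3,4,8)] assms(5,6) by (elim disjE conjE) simp_all
qed

lemma tor_components:
  "tor (a, 0) (b, 0) = (1/3) *\<^sub>R (- (mb a b, 0))" "tor (0, a) (0, b) = (1/3) *\<^sub>R (- (0, mb a b))"
  "tor (a, 0) (0, b) = (1/3) *\<^sub>R (mb a b, mb a b)"
  unfolding tor_eq scaleR_cancel_left by (simp_all add: pb_def pm_def mat2_eq_iff mat2_nth)

lemma tor_scaled:
  "tor (x1 *\<^sub>R a, x2 *\<^sub>R a) (y1 *\<^sub>R b, y2 *\<^sub>R b)
    = (1/3) *\<^sub>R ((x2*y1 + x1*y2 - x1*y1) *\<^sub>R mb a b, (x1*y2 + x2*y1 - x2*y2) *\<^sub>R mb a b)"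
  unfolding tor_eq scaleR_cancel_left by (simp add: pb_def pm_def mat2_eq_iff mat2_nth algebra_simps)

lemma linear_isometry_classification:
  fixes l :: "pt \<Rightarrow> pt"
  assumes lin: "linear l" and W: "\<And>x. x \<in> trless \<Longrightarrow> l x \<in> trless"
    and inj: "\<And>x. x \<in> trless \<Longrightarrow> l x = 0 \<Longrightarrow> x = 0" and surj: "l ` trless = trless"
    and tor: "\<And>x y. x \<in> trless \<Longrightarrow> y \<in> trless \<Longrightarrow> tor (l x) (l y) = l (tor x y)"
    and curv: "\<And>x y z. x \<in> trless \<Longrightarrow> y \<in> trless \<Longrightarrow> z \<in> trless \<Longrightarrow> l (pb (rho z x) y) = pb (rho (l z) (l x)) (l y)"
  shows "\<exists>c i j k. (det c = 1 \<or> det c = -1) \<and> (i, j, k) \<in> perms3 \<and> (\<forall>x\<in>trless. l x = conjp c (tri i j k x))"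
proof -
  have "\<forall>a. \<exists>a'. trace a = 0 \<longrightarrow> trace a' = 0 \<and> (\<forall>y\<in>trless. l (pb (a, a) y) = pb (a', a') (l y))"
    using curvature_normalizer[OF lin curv] by blast
  then obtain \<theta> where \<theta>tr: "\<And>a. trace a = 0 \<Longrightarrow> trace (\<theta> a) = 0"
    and \<theta>: "\<And>a y. trace a = 0 \<Longrightarrow> y \<in> trless \<Longrightarrow> l (pb (a, a) y) = pb (\<theta> a, \<theta> a) (l y)" by metis
  \<comment> \<open>Since \<open>l\<close> is onto and the adjoint action is faithful,
    \<open>\<theta> a\<close> is determined by its defining equation. Linearity and multiplicativity
    of the chosen \<open>\<theta>\<close> follow from this.\<close>
  have uniq: "\<theta> a = b" if a: "trace a = 0" and b: "trace b = 0"
      and eq: "\<And>y. y \<in> trless \<Longrightarrow> l (pb (a, a) y) = pb (b, b) (l y)" for a b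
  proof -
    have "pb (\<theta> a - b, \<theta> a - b) w = 0" if w: "w \<in> trless" for w
    proof -
      obtain y where y: "y \<in> trless" "w = l y" using w surj by blast
      have "pb (\<theta> a - b, \<theta> a - b) w = pb (\<theta> a, \<theta> a) (l y) - pb (b, b) (l y)"
        by (simp add: y(2) flip: pb.diff_left)
      also have "\<dots> = 0" unfolding \<theta>[OF a y(1), symmetric] eq[OF y(1), symmetric] by (rule diff_self)
      finally show ?thesis .
    qed
    moreover have "trace (\<theta> a - b) = 0" using \<theta>tr[OF a] b by (simp add: trace_sub)
    ultimately have "\<theta> a - b = 0" by (intro traceless_centralizer)
    then show ?thesis by simp
  qed
  have diag: "(r *\<^sub>R a, r *\<^sub>R a) = r *\<^sub>R (a, a)" "(a + b, a + b) = (a, a) + (b, b)" for r and a b :: mat2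
    by simp_all
  have \<theta>add: "\<theta> (a + b) = \<theta> a + \<theta> b" if "trace a = 0" "trace b = 0" for a b
    by (rule uniq) (simp_all only: that \<theta>tr trace_scaleR_add diag pb.add_left linear_add[OF lin] \<theta>)
  have \<theta>scale: "\<theta> (r *\<^sub>R a) = r *\<^sub>R \<theta> a" if "trace a = 0" for r a
    by (rule uniq) (simp_all only: that \<theta>tr trace_scaleR_add diag pb.scaleR_left linear_scale[OF lin] \<theta>)
  have dmb: "(mb a b, mb a b) = pb (a, a) (b, b)" for a b by (simp add: pb_diag)
  have jac: "pb (pb x y) z = pb x (pb y z) - pb y (pb x z)" for x y z
    using pb_jacobi[of x y z] by simp
  have \<theta>mb: "\<theta> (mb a b) = mb (\<theta> a) (\<theta> b)" if "trace a = 0" "trace b = 0" for a b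
    by (rule uniq) (simp_all only: that \<theta>tr trace_mb dmb jac linear_diff[OF lin] \<theta> pb_trless)
  have \<theta>inj: "a = 0" if "trace a = 0" "\<theta> a = 0" for a
  proof (rule traceless_centralizer[OF that(1)])
    fix w assume "w \<in> trless"
    then have "l (pb (a, a) w) = 0" using \<theta>[OF that(1)] that(2) pb.zero_left by (simp add: zero_prod_def)
    then show "pb (a, a) w = 0" using inj pb_trless by blast
  qed
  note \<theta>all = \<theta>add \<theta>scale \<theta>tr \<theta>mb \<theta>inj
  obtain c where c: "det c = 1 \<or> det c = -1" "\<And>a. trace a = 0 \<Longrightarrow> \<theta> a = det c *\<^sub>R (c ** a ** adj2 c)"
    using sl2_automorphism[OF \<theta>all] by blast
  have in1: "(a, 0) \<in> trless" "(0, a) \<in> trless" if "trace a = 0" for a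
    using that by (simp_all add: trless_def trace2[of 0])
  have tr_l: "trace (fst (l x)) = 0" "trace (snd (l x)) = 0" if "x \<in> trless" for x
    using W[OF that] by (simp_all add: trless_def)
  have emb: "linear (\<lambda>a::mat2. (a, 0::mat2))" "linear (\<lambda>a::mat2. (0::mat2, a))"
    by (auto intro!: linearI)
  have lins: "linear (\<lambda>a. fst (l (a, 0)))" "linear (\<lambda>a. snd (l (a, 0)))"
      "linear (\<lambda>a. fst (l (0, a)))" "linear (\<lambda>a. snd (l (0, a)))"
    using linear_compose[OF linear_compose[OF emb(1) lin] linear_fst] linear_compose[OF linear_compose[OF emb(1) lin] linear_snd]
      linear_compose[OF linear_compose[OF emb(2) lin] linear_fst] linear_compose[OF linear_compose[OF emb(2) lin] linear_snd]
    by (simp_all add: o_def)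
  have z: "mb a 0 = 0" for a :: mat2 by (simp add: mat2_eq_iff mat2_nth)
  have eqs: "l (mb a b, 0) = pb (\<theta> a, \<theta> a) (l (b, 0))" "l (0, mb a b) = pb (\<theta> a, \<theta> a) (l (0, b))"
    if "trace a = 0" "trace b = 0" for a b
    using \<theta>[OF that(1) in1(1)[OF that(2)]] \<theta>[OF that(1) in1(2)[OF that(2)]] by (simp_all add: pb_diag z)
  \<comment> \<open>Each of the four blocks of \<open>l\<close> intertwines the adjoint action with
    its twist by \<open>\<theta>\<close>, so Schur reduces it to one scalar.\<close>
  have "\<exists>r. \<forall>a. trace a = 0 \<longrightarrow> fst (l (a, 0)) = r *\<^sub>R \<theta> a" "\<exists>r. \<forall>a. trace a = 0 \<longrightarrow> snd (l (a, 0)) = r *\<^sub>R \<theta> a"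
    "\<exists>r. \<forall>a. trace a = 0 \<longrightarrow> fst (l (0, a)) = r *\<^sub>R \<theta> a" "\<exists>r. \<forall>a. trace a = 0 \<longrightarrow> snd (l (0, a)) = r *\<^sub>R \<theta> a"
    by (rule sl2_schur[OF lins(1) _ \<theta>all] sl2_schur[OF lins(2) _ \<theta>all] sl2_schur[OF lins(3) _ \<theta>all] sl2_schur[OF lins(4) _ \<theta>all];
        simp add: eqs pb_diag tr_l in1)+
  then obtain r t s u where rtsu: "\<And>a. trace a = 0 \<Longrightarrow> fst (l (a, 0)) = r *\<^sub>R \<theta> a" "\<And>a. trace a = 0 \<Longrightarrow> snd (l (a, 0)) = t *\<^sub>R \<theta> a"
    "\<And>a. trace a = 0 \<Longrightarrow> fst (l (0, a)) = s *\<^sub>R \<theta> a" "\<And>a. trace a = 0 \<Longrightarrow> snd (l (0, a)) = u *\<^sub>R \<theta> a" by metis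
  have l1: "l (a, 0) = (r *\<^sub>R \<theta> a, t *\<^sub>R \<theta> a)" and l2: "l (0, a) = (s *\<^sub>R \<theta> a, u *\<^sub>R \<theta> a)" if "trace a = 0" for a
    using rtsu[OF that] by (simp_all add: prod_eq_iff)
  have l12: "l x = (r *\<^sub>R \<theta> (fst x) + s *\<^sub>R \<theta> (snd x), t *\<^sub>R \<theta> (fst x) + u *\<^sub>R \<theta> (snd x))" if "x \<in> trless" for x
  proof -
    have "x = (fst x, 0) + (0, snd x)" by simp
    then have "l x = l (fst x, 0) + l (0, snd x)" using linear_add[OF lin] by metis
    then show ?thesis using that by (simp add: l1 l2 trless_def)
  qed
  note tr = trace_mh_me_mf
  have nz: "\<theta> mh \<noteq> 0" using \<theta>inj[of mh] tr by (auto simp: mh_def mat2_eq_iff)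
  have mbt: "mb (\<theta> me) (\<theta> mf) = \<theta> mh" using \<theta>mb[of me mf] tr mb_mh_me_mf by simp
  have canc: "x *\<^sub>R \<theta> mh = y *\<^sub>R \<theta> mh \<Longrightarrow> x = y" for x y using nz by simp
  have third: "(1/3::real) *\<^sub>R x = (1/3) *\<^sub>R y \<longleftrightarrow> x = y" for x y :: pt by simp
  have scale_eq: "(x *\<^sub>R \<theta> mh, y *\<^sub>R \<theta> mh) = (x' *\<^sub>R \<theta> mh, y' *\<^sub>R \<theta> mh) \<Longrightarrow> x = x' \<and> y = y'" for x y x' y'
    using canc by simp
  \<comment> \<open>Torsion invariance is tested on me and mf, whose bracket is mh; comparing
    coefficients of \<open>\<theta> mh\<close> gives the scalar equations.\<close>
  have "((t * r + r * t - r * r) *\<^sub>R \<theta> mh, (r * t + t * r - t * t) *\<^sub>R \<theta> mh) = - (r *\<^sub>R \<theta> mh, t *\<^sub>R \<theta> mh)"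
    using tor[OF in1(1)[OF tr(2)] in1(1)[OF tr(3)]]
    unfolding tor_components linear_scale[OF lin] linear_neg[OF lin] mb_mh_me_mf l1[OF tr(1)] l1[OF tr(2)] l1[OF tr(3)] tor_scaled mbt third .
  then have 1: "t * r + r * t - r * r = - r \<and> r * t + t * r - t * t = - t" by (intro scale_eq) simp
  have "((u * s + s * u - s * s) *\<^sub>R \<theta> mh, (s * u + u * s - u * u) *\<^sub>R \<theta> mh) = - (s *\<^sub>R \<theta> mh, u *\<^sub>R \<theta> mh)"
    using tor[OF in1(2)[OF tr(2)] in1(2)[OF tr(3)]]
    unfolding tor_components linear_scale[OF lin] linear_neg[OF lin] mb_mh_me_mf l2[OF tr(1)] l2[OF tr(2)] l2[OF tr(3)] tor_scaled mbt third .
  then have 2: "u * s + s * u - s * s = - s \<and> s * u + u * s - u * u = - u" by (intro scale_eq) simp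
  have "(mh, mh) = (mh, 0) + (0, mh)" by simp
  then have "l (mh, mh) = ((r + s) *\<^sub>R \<theta> mh, (t + u) *\<^sub>R \<theta> mh)"
    using linear_add[OF lin, of "(mh, 0)" "(0, mh)"] l1[OF tr(1)] l2[OF tr(1)] by (simp add: scaleR_add_left)
  then have "((t * s + r * u - r * s) *\<^sub>R \<theta> mh, (r * u + t * s - t * u) *\<^sub>R \<theta> mh) = ((r + s) *\<^sub>R \<theta> mh, (t + u) *\<^sub>R \<theta> mh)"
    using tor[OF in1(1)[OF tr(2)] in1(2)[OF tr(3)]]
    unfolding tor_components linear_scale[OF lin] linear_neg[OF lin] mb_mh_me_mf l1[OF tr(2)] l2[OF tr(3)] tor_scaled mbt third by simp
  then have 3: "t * s + r * u - r * s = r + s \<and> r * u + t * s - t * u = t + u" by (rule scale_eq)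
  have "(mh, 0) \<noteq> (0::pt)" "(0, mh) \<noteq> (0::pt)" by (auto simp: mh_def mat2_eq_iff zero_prod_def)
  then have nz': "l (mh, 0) \<noteq> 0" "l (0, mh) \<noteq> 0" using inj in1 tr by blast+
  then have 4: "r \<noteq> 0 \<or> t \<noteq> 0" "s \<noteq> 0 \<or> u \<noteq> 0" by (auto simp: l1 l2 tr zero_prod_def)
  define f where "f a = det c *\<^sub>R (c ** a ** adj2 c)" for a
  have conjf: "conjp c x = (f (fst x), f (snd x))" for x by (simp add: conjp_def f_def)
  have f: "f (a - b) = f a - f b" "f (- a) = - f a" "f 0 = 0" for a b
    using z[of c] by (simp_all add: f_def mat2_mult_scale_diff scaleR_diff_right)
  have lf: "l x = (r *\<^sub>R f (fst x) + s *\<^sub>R f (snd x), t *\<^sub>R f (fst x) + u *\<^sub>R f (snd x))" if "x \<in> trless" for x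
    using l12[OF that] that by (simp add: c(2) f_def trless_def)
  have "(r, t, s, u) \<in> {(1,0,0,1), (0,1,1,0), (1,0,-1,-1), (-1,-1,0,1), (0,1,-1,-1), (-1,-1,1,0)}"
    by (rule tri_coefficients) (use 1 2 3 4 in blast)+
  then have "\<exists>i j k. (i, j, k) \<in> perms3 \<and> (\<forall>x\<in>trless. l x = conjp c (tri i j k x))"
  proof (elim insertE emptyE)
    assume "(r, t, s, u) = (1,0,0,1)"
    then show ?thesis by (intro exI[of _ 0] exI[of _ 1] exI[of _ 2]) (simp add: perms3_def lf conjf tri_def pick3_def f)
  next
    assume "(r, t, s, u) = (0,1,1,0)"
    then show ?thesis by (intro exI[of _ 1] exI[of _ 0] exI[of _ 2]) (simp add: perms3_def lf conjf tri_def pick3_def f)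
  next
    assume "(r, t, s, u) = (1,0,-1,-1)"
    then show ?thesis by (intro exI[of _ 0] exI[of _ 2] exI[of _ 1]) (simp add: perms3_def lf conjf tri_def pick3_def f)
  next
    assume "(r, t, s, u) = (-1,-1,0,1)"
    then show ?thesis by (intro exI[of _ 2] exI[of _ 1] exI[of _ 0]) (simp add: perms3_def lf conjf tri_def pick3_def f)
  next
    assume "(r, t, s, u) = (0,1,-1,-1)"
    then show ?thesis by (intro exI[of _ 2] exI[of _ 0] exI[of _ 1]) (simp add: perms3_def lf conjf tri_def pick3_def f)
  next
    assume "(r, t, s, u) = (-1,-1,1,0)"
    then show ?thesis by (intro exI[of _ 1] exI[of _ 2] exI[of _ 0]) (simp add: perms3_def lf conjf tri_def pick3_def f)
  qed
  with c(1) show ?thesis by blast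
qed

section \<open>Uniqueness along unipotent one-parameter groups\<close>

text \<open>The sum h of squared norms satisfies h' \<le> K h, so h exp(-K t) does not increase from
  its initial value 0. The cardinality in \<open>K\<close> comes from bounding the squared sum of
  norms by the sum of squares.\<close>

lemma gronwall_zero:
  fixes e e' :: "'i \<Rightarrow> real \<Rightarrow> 'a::real_inner"
  assumes I: "finite I"
    and d: "\<And>i t. i \<in> I \<Longrightarrow> 0 \<le> t \<Longrightarrow> t \<le> 1 \<Longrightarrow> (e i has_vector_derivative e' i t) (at t)"
    and le: "\<And>i t. i \<in> I \<Longrightarrow> 0 \<le> t \<Longrightarrow> t \<le> 1 \<Longrightarrow> norm (e' i t) \<le> C * (\<Sum>j\<in>I. norm (e j t))"
    and z: "\<And>i. i \<in> I \<Longrightarrow> e i 0 = 0"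
    and i: "i \<in> I" and t: "0 \<le> t" "t \<le> 1"
  shows "e i t = 0"
proof -
  define D where "D = \<bar>C\<bar>"
  define h where "h t = (\<Sum>i\<in>I. e i t \<bullet> e i t)" for t
  define h' where "h' t = (\<Sum>i\<in>I. 2 * (e i t \<bullet> e' i t))" for t
  define K where "K = 2 * D * card I"
  have h: "(h has_real_derivative h' t) (at t)" if "0 \<le> t" "t \<le> 1" for t
    unfolding h_def h'_def
    using d[OF _ that] by (auto intro!: derivative_eq_intros simp: has_real_derivative_iff_has_vector_derivative inner_commute
      has_vector_derivative_def sum_distrib_left ac_simps)
  have h': "h' t \<le> K * h t" if "0 \<le> t" "t \<le> 1" for t
  proof -
    define s where "s = (\<Sum>j\<in>I. norm (e j t))"
    have "s \<ge> 0" by (simp add: s_def sum_nonneg)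
    have "2 * (e i t \<bullet> e' i t) \<le> 2 * (norm (e i t) * (D * s))" if i: "i \<in> I" for i
    proof -
      have "e i t \<bullet> e' i t \<le> norm (e i t) * norm (e' i t)" by (rule norm_cauchy_schwarz)
      also have "norm (e' i t) \<le> C * s" unfolding s_def by (rule le[OF i \<open>0 \<le> t\<close> \<open>t \<le> 1\<close>])
      also have "C * s \<le> D * s" using \<open>s \<ge> 0\<close> by (intro mult_right_mono) (simp_all add: D_def)
      finally show ?thesis by (simp add: mult_left_mono)
    qed
    then have "h' t \<le> (\<Sum>i\<in>I. 2 * (norm (e i t) * (D * s)))" unfolding h'_def by (rule sum_mono)
    also have "\<dots> = 2 * D * s\<^sup>2"
      by (simp add: s_def power2_eq_square flip: sum_distrib_left sum_distrib_right)
    also have "s\<^sup>2 \<le> card I * (\<Sum>j\<in>I. (norm (e j t))\<^sup>2)"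
      unfolding s_def using sum_squared_le_sum_of_squares[of "\<lambda>j. norm (e j t)" I] I by (simp add: mult.commute)
    also have "(\<Sum>j\<in>I. (norm (e j t))\<^sup>2) = h t" by (simp add: h_def power2_norm_eq_inner)
    finally show ?thesis by (simp add: K_def D_def mult_left_mono mult.assoc)
  qed
  have "h t * exp (- K * t) \<le> h 0 * exp (- K * 0)"
  proof (rule DERIV_nonpos_imp_nonincreasing[OF t(1)])
    fix u assume u: "0 \<le> u" "u \<le> t"
    have "((\<lambda>t. h t * exp (- K * t)) has_real_derivative (h' u - K * h u) * exp (- K * u)) (at u)"
      using u t by (auto intro!: derivative_eq_intros h simp: algebra_simps)
    moreover have "(h' u - K * h u) * exp (- K * u) \<le> 0"
      using h'[of u] u t by (simp add: mult_nonpos_nonneg)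
    ultimately show "\<exists>y. ((\<lambda>t. h t * exp (- K * t)) has_real_derivative y) (at u) \<and> y \<le> 0" by blast
  qed
  moreover have "h 0 = 0" by (simp add: h_def z)
  ultimately have "h t \<le> 0" by (simp add: mult_le_0_iff)
  moreover have "e i t \<bullet> e i t \<le> h t" unfolding h_def by (rule member_le_sum[OF i _ I]) simp
  ultimately have "e i t \<bullet> e i t \<le> 0" by linarith
  then have "e i t \<bullet> e i t = 0" using inner_ge_zero[of "e i t"] by linarith
  then show ?thesis by simp
qed

text \<open>As n squares to zero, p (1 + t n) n = p n: the line is an integral curve of the
  left-invariant field of n.\<close>

lemma lderiv_along:
  assumes n: "n \<in> nilp" and f: "f differentiable at (pm p (pone + t *\<^sub>R n))"
  shows "((\<lambda>t. f (pm p (pone + t *\<^sub>R n))) has_vector_derivative lderiv n f (pm p (pone + t *\<^sub>R n))) (at t)"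
proof -
  have *: "pm p (pone + t *\<^sub>R n) = p + t *\<^sub>R pm p n" for t
    by (simp add: pm.add_right pm.scaleR_right)
  have "pm (pm p (pone + t *\<^sub>R n)) n = pm p n"
    using nilp_square[OF n] by (simp add: pm_assoc pm.add_left pm.scaleR_left)
  then show ?thesis using line_has_vector_derivative[of f p t "pm p n"] f by (simp add: * lderiv_def)
qed

text \<open>Projecting the ambient basis gives a finite spanning family of \<open>trless\<close>
  indexed by \<open>Basis\<close>, without choosing a basis of \<open>trless\<close>.\<close>

definition trless_proj :: "pt \<Rightarrow> pt" where
  "trless_proj x = (1/2) *\<^sub>R (x - padj x)"

lemma linear_trless_proj: "linear trless_proj"
  by (rule linearI) (simp_all add: trless_proj_def linear_add[OF linear_padj] linear_scale[OF linear_padj] algebra_simps)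

lemma trless_proj_in: "trless_proj x \<in> trless"
  by (simp add: trless_proj_def trless_def padj_def trace2 adj2_nth) (simp add: field_simps)

lemma trless_proj_eq:
  assumes "x \<in> trless"
  shows "trless_proj x = x"
proof -
  have "padj x = - x" using assms by (simp add: trless_iff_padj add_eq_0_iff)
  then show ?thesis by (simp add: trless_proj_def flip: scaleR_2)
qed

lemma SL2_unipotent_product:
  assumes "det (A::mat2) = 1"
  shows "\<exists>x y z w. A = (mat 1 + x *\<^sub>R me) ** (mat 1 + y *\<^sub>R mf) ** (mat 1 + z *\<^sub>R me) ** (mat 1 + w *\<^sub>R mf)"
proof -
  have 3: "\<exists>x y z. B = (mat 1 + x *\<^sub>R me) ** (mat 1 + y *\<^sub>R mf) ** (mat 1 + z *\<^sub>R me)"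
    if B: "det B = 1" "B$2$1 \<noteq> 0" for B :: mat2
  proof -
    define c where "c = B$2$1"
    have "B$1$2 * c = B$1$1 * B$2$2 - 1" using B by (simp add: det_2 c_def)
    moreover have c0: "c \<noteq> 0" using B by (simp add: c_def)
    ultimately have "B$1$2 = (B$1$1 * B$2$2 - 1) / c" by (simp add: eq_divide_eq)
    also have "\<dots> = (B$1$1 - 1) / c + (1 + (B$1$1 - 1) / c * c) * ((B$2$2 - 1) / c)"
      using c0 by (simp add: field_simps)
    finally have "B$1$2 = (B$1$1 - 1) / c + (1 + (B$1$1 - 1) / c * c) * ((B$2$2 - 1) / c)" .
    \<comment> \<open>Multiplying out three factors, the lower left entry is y and the diagonal
      entries are 1 + x y and 1 + y z. This fixes the witnesses; the determinant gives the remaining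
      entry.\<close>
    then show ?thesis using B
      by (intro exI[of _ "(B$1$1 - 1) / c"] exI[of _ c] exI[of _ "(B$2$2 - 1) / c"])
         (simp add: mat2_eq_iff mat2_nth me_def mf_def c_def)
  qed
  \<comment> \<open>If A has lower left entry 0, its diagonal entries are nonzero and one lower
    unipotent factor makes that entry nonzero.\<close>
  define w where "w = (if A$2$1 = 0 then 1 else 0::real)"
  define B where "B = A ** (mat 1 - w *\<^sub>R mf)"
  have "A = B ** (mat 1 + w *\<^sub>R mf)"
    by (simp add: B_def mat2_eq_iff mat2_nth mf_def algebra_simps)
  moreover have "B$2$1 \<noteq> 0" using assms by (auto simp: B_def w_def mat2_nth mf_def)
  moreover have "det B = 1" using assms by (simp add: B_def det_mul) (simp add: mat2_nth mf_def)
  ultimately show ?thesis using 3 by metis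
qed

text \<open>Both components are factored in the same pattern, so each step multiplies by a single
  pair of unipotents.\<close>

lemma NN_induct [consumes 1, case_names pone step]:
  assumes p: "p \<in> NN" and one: "P pone" and step: "\<And>p n. p \<in> NN \<Longrightarrow> P p \<Longrightarrow> n \<in> nilp \<Longrightarrow> P (pm p (pone + n))"
  shows "P p"
proof -
  obtain x y z w x' y' z' w' where
    p1: "fst p = (mat 1 + x *\<^sub>R me) ** (mat 1 + y *\<^sub>R mf) ** (mat 1 + z *\<^sub>R me) ** (mat 1 + w *\<^sub>R mf)" and
    p2: "snd p = (mat 1 + x' *\<^sub>R me) ** (mat 1 + y' *\<^sub>R mf) ** (mat 1 + z' *\<^sub>R me) ** (mat 1 + w' *\<^sub>R mf)"
    using SL2_unipotent_product p unfolding NN_iff by metis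
  define N where "N x x' m = (x *\<^sub>R m, x' *\<^sub>R m)" for x x' and m :: mat2
  have N: "N x x' me \<in> nilp" "N x x' mf \<in> nilp" for x x'
    by (simp_all add: N_def nilp_def trless_def me_def mf_def mat2_nth)
  have inNN: "pone + N x x' me \<in> NN" "pone + N x x' mf \<in> NN" for x x'
    using one_plus_nilp_in_NN[OF N(1), of 1] one_plus_nilp_in_NN[OF N(2), of 1] by simp_all
  have "p = pm (pm (pm (pm pone (pone + N x x' me)) (pone + N y y' mf)) (pone + N z z' me)) (pone + N w w' mf)"
    unfolding pt_eq_iff p1 p2 by (simp add: pm_def pone_def N_def)
  moreover have "P \<dots>" by (intro step one N pm_in_NN inNN pone_in_NN)
  ultimately show ?thesis by simp
qed

lemma continuous_bounded_01:
  fixes f :: "real \<Rightarrow> 'a::real_normed_vector"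
  assumes "\<And>t. (f has_vector_derivative f' t) (at t)"
  shows "\<exists>M. \<forall>t. 0 \<le> t \<longrightarrow> t \<le> 1 \<longrightarrow> norm (f t) \<le> M"
proof -
  have "continuous_on {0..1} f"
    using assms by (intro continuous_at_imp_continuous_on ballI has_vector_derivative_continuous)
  then have "bounded (f ` {0..1})" by (intro compact_imp_bounded compact_continuous_image) auto
  then obtain M where "\<forall>x\<in>f ` {0..1}. norm x \<le> M" unfolding bounded_iff by blast
  then show ?thesis by (intro exI[of _ M]) auto
qed

text \<open>Along a unipotent one-parameter group both \<open>ldiff\<close> and the map itself solve an
  autonomous ordinary differential equation that does not depend on the map.\<close>

lemma nk_map_unique:
  assumes G: "nk_map G U \<epsilon>" and K: "nk_map K V \<delta>" and eq: "G pone = K pone"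
    and Leq: "\<And>x. x \<in> trless \<Longrightarrow> ldiff G x pone = ldiff K x pone" and p: "p \<in> NN"
  shows "G p = K p"
proof -
  interpret G: nk_map G U \<epsilon> by (rule G)
  interpret K: nk_map K V \<delta> by (rule K)
  have "G p = K p \<and> (\<forall>x\<in>trless. ldiff G x p = ldiff K x p)"
    using p
  proof (induction rule: NN_induct)
    case pone
    then show ?case using eq Leq by blast
  next
    case (step p n)
    define \<gamma> where "\<gamma> t = pm p (pone + t *\<^sub>R n)" for t
    have \<gamma>: "\<gamma> t \<in> NN" for t unfolding \<gamma>_def using step by (intro pm_in_NN one_plus_nilp_in_NN)
    then have \<gamma>U: "\<gamma> t \<in> U" "\<gamma> t \<in> V" for t using G.NN_U K.NN_U by auto
    have \<gamma>0: "\<gamma> 0 = p" by (simp add: \<gamma>_def)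
    note n = nilp_trless[OF step(2)]
    have along: "((\<lambda>t. f (\<gamma> t)) has_vector_derivative lderiv n f (\<gamma> t)) (at t)"
      if "f differentiable at (\<gamma> t)" for f :: "pt \<Rightarrow> pt" and t
      using lderiv_along[OF step(2)] that unfolding \<gamma>_def .
    define D where "D x t = ldiff G x (\<gamma> t) - ldiff K x (\<gamma> t)" for x t
    \<comment> \<open>The term \<open>pb (mu (L n)) (L x)\<close> is quadratic in \<open>L\<close>.
      Telescoping its difference makes the equation linear in \<open>D\<close>, with coefficients
      bounded along the curve.\<close>
    define D' where "D' x t = D (pb (mu n) x) t - pb (mu (D n t)) (ldiff G x (\<gamma> t)) - pb (mu (ldiff K n (\<gamma> t))) (D x t)" for x t
    have dD: "(D x has_vector_derivative D' x t) (at t)" if x: "x \<in> trless" for x t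
    proof -
      have "(D x has_vector_derivative lderiv n (ldiff G x) (\<gamma> t) - lderiv n (ldiff K x) (\<gamma> t)) (at t)"
        unfolding D_def by (intro has_vector_derivative_diff along G.differentiable_L K.differentiable_L \<gamma>U)
      moreover have "lderiv n (ldiff G x) (\<gamma> t) - lderiv n (ldiff K x) (\<gamma> t) = D' x t"
        unfolding G.parallel[OF \<gamma> x n] K.parallel[OF \<gamma> x n] D'_def D_def mu_linear pb.diff_left pb.diff_right
        by simp
      ultimately show ?thesis by simp
    qed
    define e where "e b = D (trless_proj b)" for b
    define S where "S t = (\<Sum>b\<in>Basis. norm (e b t))" for t
    have "bounded_bilinear (\<lambda>u v. pb (mu u) v)"
      using bounded_bilinear.comp1[OF pb.bounded_bilinear_axioms] linear_mu linear_conv_bounded_linear by blast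
    then obtain k where k: "k > 0" "\<And>u v. norm (pb (mu u) v) \<le> norm u * norm v * k"
      using bounded_bilinear.pos_bounded by blast
    have S0: "S t \<ge> 0" for t by (simp add: S_def sum_nonneg)
    have linD: "linear (\<lambda>x. D x t)" for t
      unfolding D_def using linear_compose_sub[OF G.linear_L K.linear_L] \<gamma>U by blast
    have D_le: "norm (D x t) \<le> norm x * S t" if x: "x \<in> trless" for x t
    proof -
      have "x = trless_proj (\<Sum>b\<in>Basis. (x \<bullet> b) *\<^sub>R b)"
        unfolding euclidean_representation trless_proj_eq[OF x] ..
      also have "\<dots> = (\<Sum>b\<in>Basis. (x \<bullet> b) *\<^sub>R trless_proj b)"
        using linear_sum[OF linear_trless_proj, of "\<lambda>b. (x \<bullet> b) *\<^sub>R b" Basis]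
        unfolding linear_scale[OF linear_trless_proj] .
      finally have "D x t = D (\<Sum>b\<in>Basis. (x \<bullet> b) *\<^sub>R trless_proj b) t" by (rule arg_cong)
      also have "\<dots> = (\<Sum>b\<in>Basis. (x \<bullet> b) *\<^sub>R e b t)"
        using linear_sum[OF linD, of "\<lambda>b. (x \<bullet> b) *\<^sub>R trless_proj b" Basis]
        unfolding linear_scale[OF linD] e_def .
      finally have "norm (D x t) \<le> (\<Sum>b\<in>Basis. norm ((x \<bullet> b) *\<^sub>R e b t))"
        using norm_sum[of "\<lambda>b. (x \<bullet> b) *\<^sub>R e b t" Basis] by (rule ord_eq_le_trans[OF arg_cong])
      also have "\<dots> \<le> (\<Sum>b\<in>Basis. norm x * norm (e b t))"
        by (intro sum_mono) (simp add: mult_right_mono Basis_le_norm)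
      finally show ?thesis by (simp add: S_def sum_distrib_left)
    qed
    have bdd: "\<exists>M. \<forall>t. 0 \<le> t \<longrightarrow> t \<le> 1 \<longrightarrow> norm (f (\<gamma> t)) \<le> M" if "\<And>t. f differentiable at (\<gamma> t)" for f :: "pt \<Rightarrow> pt"
      by (rule continuous_bounded_01[OF along[OF that]])
    have "\<forall>b. \<exists>M. \<forall>t. 0 \<le> t \<longrightarrow> t \<le> 1 \<longrightarrow> norm (ldiff G (trless_proj b) (\<gamma> t)) \<le> M"
      by (intro allI bdd G.differentiable_L \<gamma>U)
    then obtain M1 where M1: "\<And>b t. 0 \<le> t \<Longrightarrow> t \<le> 1 \<Longrightarrow> norm (ldiff G (trless_proj b) (\<gamma> t)) \<le> M1 b" by metis
    obtain M2 where M2: "\<And>t. 0 \<le> t \<Longrightarrow> t \<le> 1 \<Longrightarrow> norm (ldiff K n (\<gamma> t)) \<le> M2"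
      using bdd[OF K.differentiable_L[OF \<gamma>U(2)]] by blast
    define c where "c b = norm (pb (mu n) (trless_proj b)) + norm n * M1 b * k + M2 * norm (trless_proj b) * k" for b
    define C where "C = (\<Sum>b\<in>Basis. \<bar>c b\<bar>)"
    have e_le: "norm (D' (trless_proj b) t) \<le> C * S t" if b: "b \<in> Basis" and t: "0 \<le> t" "t \<le> 1" for b t
    proof -
      note P = trless_proj_in[of b]
      have "norm (D (pb (mu n) (trless_proj b)) t) \<le> norm (pb (mu n) (trless_proj b)) * S t"
        by (rule D_le[OF pb_trless])
      moreover have "norm (pb (mu (D n t)) (ldiff G (trless_proj b) (\<gamma> t))) \<le> (norm n * S t) * M1 b * k"
        using D_le[OF n, of t] M1[OF t, of b] k(1) S0[of t]
        by (intro order_trans[OF k(2)] mult_right_mono mult_mono) auto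
      moreover have "norm (pb (mu (ldiff K n (\<gamma> t))) (D (trless_proj b) t)) \<le> M2 * (norm (trless_proj b) * S t) * k"
        using D_le[OF P, of t] M2[OF t] k(1) S0[of t] order_trans[OF norm_ge_zero M2[OF t]]
        by (intro order_trans[OF k(2)] mult_right_mono mult_mono) auto
      ultimately have "norm (D' (trless_proj b) t) \<le> norm (pb (mu n) (trless_proj b)) * S t
          + (norm n * S t) * M1 b * k + M2 * (norm (trless_proj b) * S t) * k"
        unfolding D'_def by (intro order_trans[OF norm_triangle_ineq4] add_mono) auto
      also have "\<dots> = c b * S t" by (simp add: c_def algebra_simps)
      also have "\<dots> \<le> C * S t"
      proof (rule mult_right_mono[OF _ S0])
        have "\<bar>c b\<bar> \<le> C" unfolding C_def using b by (intro member_le_sum) auto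
        then show "c b \<le> C" by simp
      qed
      finally show ?thesis .
    qed
    have "e b t = 0" if "b \<in> Basis" "0 \<le> t" "t \<le> 1" for b t
    proof (rule gronwall_zero[where I = Basis and e' = "\<lambda>b. D' (trless_proj b)" and C = C, OF finite_Basis _ _ _ that])
      show "e b 0 = 0" for b using step(3) trless_proj_in by (simp add: e_def D_def \<gamma>0)
    qed (use dD[OF trless_proj_in] e_le in \<open>auto simp: e_def S_def\<close>)
    then have "S t = 0" if "0 \<le> t" "t \<le> 1" for t using that by (simp add: S_def)
    then have Deq: "ldiff G x (\<gamma> t) = ldiff K x (\<gamma> t)" if "x \<in> trless" "0 \<le> t" "t \<le> 1" for x t
      using D_le[OF that(1), of t] that by (simp add: D_def)
    obtain k' where k': "k' > 0" "\<And>u v. norm (pm u v) \<le> norm u * norm v * k'"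
      using pm.pos_bounded by blast
    \<comment> \<open>With the differentials already equal, G - K itself solves a linear equation,
      so a second Gronwall argument with a one-element index set finishes.\<close>
    have "G (\<gamma> t) - K (\<gamma> t) = 0" if t: "0 \<le> t" "t \<le> 1" for t
    proof (rule gronwall_zero[where I = "{()}" and e = "\<lambda>_ t. G (\<gamma> t) - K (\<gamma> t)" and C = "M2 * k'"
          and e' = "\<lambda>_ t. lderiv n G (\<gamma> t) - lderiv n K (\<gamma> t)", OF _ _ _ _ _ t])
      show "((\<lambda>t. G (\<gamma> t) - K (\<gamma> t)) has_vector_derivative lderiv n G (\<gamma> t) - lderiv n K (\<gamma> t)) (at t)" for t
        by (intro has_vector_derivative_diff along G.differentiable_G K.differentiable_G \<gamma>U)
      fix t :: real assume t: "0 \<le> t" "t \<le> 1"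
      have "lderiv n G (\<gamma> t) - lderiv n K (\<gamma> t) = pm (G (\<gamma> t) - K (\<gamma> t)) (ldiff K n (\<gamma> t))"
        by (simp add: G.lderiv_G K.lderiv_G \<gamma> Deq n t pm.diff_left)
      also have "norm \<dots> \<le> norm (G (\<gamma> t) - K (\<gamma> t)) * M2 * k'"
        using k'(1) M2[OF t] by (intro order_trans[OF k'(2)] mult_right_mono mult_left_mono) auto
      finally show "norm (lderiv n G (\<gamma> t) - lderiv n K (\<gamma> t)) \<le> M2 * k' * (\<Sum>j\<in>{()}. norm (G (\<gamma> t) - K (\<gamma> t)))"
        by (simp add: algebra_simps)
    qed (use step(3) \<gamma>0 in auto)
    then have "G (\<gamma> 1) = K (\<gamma> 1)" by simp
    then show ?case using Deq[of _ 1] by (simp add: \<gamma>_def)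
  qed
  then show ?thesis ..
qed

section \<open>The model isometries\<close>

lemma diff_times_foldr: "diff_times (n + length vs) U f \<Longrightarrow> diff_times n U (foldr dirderiv vs f)"
proof (induction vs arbitrary: n)
  case (Cons v vs)
  have "diff_times (Suc n) U (foldr dirderiv vs f)" using Cons by simp
  then show ?case by (simp add: diff_times_dirderiv)
qed simp

lemma smooth_onI:
  assumes "open U" "\<And>n. diff_times n U f"
  shows "smooth_on U f"
  using assms diff_times_foldr[of 0] diff_times_differentiable unfolding smooth_on_def by fastforce

lemma diff_times_Pair:
  assumes "open U" "diff_times n U f" "diff_times n U g"
  shows "diff_times n U (\<lambda>x. (f x, g x))"
proof -
  have "diff_times n U (\<lambda>x. (f x, 0) + (0, g x))"
    by (intro diff_times_add diff_times_linear[OF assms(1) _ assms(2)] diff_times_linear[OF assms(1) _ assms(3)] assms(1)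
        bounded_linear_Pair bounded_linear_ident bounded_linear_zero)
  then show ?thesis by simp
qed

text \<open>Entry i of the product of (a, b, c) with the lift (p, q, 1) of the point in
  \<open>G^3\<close>.\<close>

definition gmat :: "nat \<Rightarrow> mat2 \<Rightarrow> mat2 \<Rightarrow> mat2 \<Rightarrow> pt \<Rightarrow> mat2" where
  "gmat i a b c p = pick3 i (a ** fst p) (b ** snd p) c"

definition Emap :: "nat \<Rightarrow> nat \<Rightarrow> mat2 \<Rightarrow> mat2 \<Rightarrow> mat2 \<Rightarrow> pt \<Rightarrow> pt" where
  "Emap i j a b c p = (gmat i a b c p, gmat j a b c p)"

text \<open>The action of \<open>(a, b, c)\<close> and a permutation on \<open>G^3 / \<Delta> G\<close>, as a polynomial map:
  \<open>det c *\<^sub>R padj\<close> is the inverse on matrices of determinant \<open>det c = \<plusminus>1\<close>.\<close>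

definition Kmap :: "nat \<Rightarrow> nat \<Rightarrow> nat \<Rightarrow> mat2 \<Rightarrow> mat2 \<Rightarrow> mat2 \<Rightarrow> pt \<Rightarrow> pt" where
  "Kmap i j k a b c p = det c *\<^sub>R pm (Emap i j a b c p) (padj (Emap k k a b c p))"

lemma bounded_linear_mult_fst_snd:
  "bounded_linear (\<lambda>p::pt. (a::mat2) ** fst p)" "bounded_linear (\<lambda>p::pt. (a::mat2) ** snd p)"
proof -
  have "linear (\<lambda>p::pt. a ** fst p)" "linear (\<lambda>p::pt. a ** snd p)"
    by (auto intro!: linearI simp: mat2_mult_scale_diff mat2_mult_scaleR)
  then show "bounded_linear (\<lambda>p::pt. a ** fst p)" "bounded_linear (\<lambda>p::pt. a ** snd p)"
    by (simp_all only: linear_conv_bounded_linear)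
qed

lemma diff_times_gmat: "diff_times n UNIV (gmat i a b c)"
  unfolding gmat_def pick3_def
  by (cases "i = 0"; cases "i = 1")
     (simp_all add: diff_times_bounded_linear bounded_linear_mult_fst_snd diff_times_const)

lemma diff_times_Emap: "diff_times n UNIV (Emap i j a b c)"
  unfolding Emap_def by (intro diff_times_Pair diff_times_gmat open_UNIV)

lemma diff_times_Kmap: "diff_times n UNIV (Kmap i j k a b c)"
  unfolding Kmap_def
  by (rule diff_times_linear[OF open_UNIV bounded_linear_scaleR_right
        diff_times_bilinear[OF open_UNIV pm.bounded_bilinear_axioms diff_times_Emap
          diff_times_linear[OF open_UNIV linear_padj[unfolded linear_conv_bounded_linear] diff_times_Emap]]])

lemma lderiv_Emap:
  "lderiv x (Emap i j a b c) p = pm (Emap i j a b c p) (pick3 i (fst x) (snd x) 0, pick3 j (fst x) (snd x) 0)"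
proof -
  have 1: "(gmat i a b c has_derivative (\<lambda>v. pick3 i (a ** fst v) (b ** snd v) 0)) (at p)" for i
    unfolding gmat_def pick3_def
    by (cases "i = 0"; cases "i = 1")
       (simp_all add: bounded_linear_imp_has_derivative bounded_linear_mult_fst_snd)
  have z: "m ** 0 = 0" for m :: mat2 by (simp add: mat2_eq_iff mat2_mult_nth)
  have "(Emap i j a b c has_derivative (\<lambda>v. (pick3 i (a ** fst v) (b ** snd v) 0, pick3 j (a ** fst v) (b ** snd v) 0))) (at p)"
    unfolding Emap_def by (intro has_derivative_Pair 1)
  from dirderiv_eqI[OF this, of "pm p x"] show ?thesis
    by (simp add: lderiv_def pm_def Emap_def gmat_def pick3_def matrix_mul_assoc z)
qed

lemma padj_padj: "padj (padj x) = x"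
  by (simp add: padj_def pt_eq_iff mat2_eq_iff adj2_nth)

lemma padj_scaleR: "padj (r *\<^sub>R x) = r *\<^sub>R padj x"
  by (rule linear_scale[OF linear_padj])

text \<open>The logarithmic derivative of A B^{-1} is y - z conjugated by B. The signs d account for
  \<open>padj\<close> being d times the inverse.\<close>

lemma ldiff_quotient:
  assumes A: "A differentiable at p" "lderiv x A p = pm (A p) y"
    and B: "B differentiable at p" "lderiv x B p = pm (B p) z" and z: "z \<in> trless"
    and d: "pm (padj (A p)) (A p) = d *\<^sub>R pone" "d * d = 1"
  shows "ldiff (\<lambda>q. d *\<^sub>R pm (A q) (padj (B q))) x p = d *\<^sub>R pm (B p) (pm (y - z) (padj (B p)))"
proof -
  note bil = pm.bounded_bilinear_axioms
  note dp = differentiable_linear_compose[OF linear_padj[unfolded linear_conv_bounded_linear] B(1)]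
  have zz: "padj z = - z" using z by (simp add: trless_iff_padj add_eq_0_iff)
  have "lderiv x (\<lambda>q. d *\<^sub>R pm (A q) (padj (B q))) p = d *\<^sub>R lderiv x (\<lambda>q. pm (A q) (padj (B q))) p"
    unfolding lderiv_def
    by (rule dirderiv_linear_compose[OF bounded_linear_scaleR_right differentiable_bilinear[OF bil A(1) dp]])
  also have "lderiv x (\<lambda>q. pm (A q) (padj (B q))) p = pm (A p) (padj (pm (B p) z)) + pm (pm (A p) y) (padj (B p))"
    by (simp add: lderiv_bilinear[OF bil A(1) dp] lderiv_linear_compose[OF linear_padj B(1)] A(2) B(2))
  also have "\<dots> = pm (A p) (pm (y - z) (padj (B p)))"
    by (simp add: padj_pm zz pm_assoc pm.minus_left pm.minus_right pm.diff_left pm.diff_right)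
  finally have "ldiff (\<lambda>q. d *\<^sub>R pm (A q) (padj (B q))) x p
      = (d * d) *\<^sub>R pm (B p) (pm (pm (padj (A p)) (A p)) (pm (y - z) (padj (B p))))"
    by (simp add: ldiff_def padj_scaleR padj_pm padj_padj pm.scaleR_left pm.scaleR_right pm_assoc)
  then show ?thesis by (simp add: d pm.scaleR_left pm.scaleR_right)
qed

lemma det_scaleR_pm1: "d = 1 \<or> d = -1 \<Longrightarrow> det (d *\<^sub>R (m::mat2)) = det m"
  by (auto simp: det_2)

context
  fixes a b c :: mat2 and d :: real
  assumes d: "d = 1 \<or> d = -1" and dets: "det a = d" "det b = d" "det c = d"
begin

lemma det_gmat: "p \<in> NN \<Longrightarrow> det (gmat i a b c p) = d"
  by (simp add: gmat_def pick3_def det_mul NN_iff dets)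

lemma Kmap_eq: "p \<in> NN \<Longrightarrow> Kmap i j k a b c p =
    (gmat i a b c p ** matrix_inv (gmat k a b c p), gmat j a b c p ** matrix_inv (gmat k a b c p))"
  using d det_gmat[of p k]
  by (auto simp: Kmap_def Emap_def pm_def padj_def matrix_inv_eq_adj2 dets mat2_mult_scaleR mat2_mult_scale_diff)

lemma Kmap_in_NN: "p \<in> NN \<Longrightarrow> Kmap i j k a b c p \<in> NN"
  using d by (auto simp: Kmap_def Emap_def pm_def padj_def NN_iff dets det_scaleR_pm1 det_mul det_gmat)

lemma ldiff_Kmap:
  assumes p: "p \<in> NN" and x: "x \<in> trless"
  shows "ldiff (Kmap i j k a b c) x p = conjp (gmat k a b c p) (tri i j k x)"
proof -
  let ?z = "(pick3 k (fst x) (snd x) 0, pick3 k (fst x) (snd x) 0)"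
  have E: "Emap i j a b c differentiable at p" for i j
    using diff_times_differentiable[OF diff_times_Emap] by blast
  have 1: "?z \<in> trless" using x by (simp add: trless_def pick3_def trace2[of 0])
  have 2: "pm (padj (Emap i j a b c p)) (Emap i j a b c p) = d *\<^sub>R pone"
    using mat_eq_scaleR[of d] by (simp add: pm_def padj_def Emap_def mult_adj2 det_gmat p pone_def)
  have 3: "d * d = 1" using d by auto
  have "Kmap i j k a b c = (\<lambda>q. d *\<^sub>R pm (Emap i j a b c q) (padj (Emap k k a b c q)))"
    by (simp add: Kmap_def fun_eq_iff dets)
  then have "ldiff (Kmap i j k a b c) x p = d *\<^sub>R pm (Emap k k a b c p)
      (pm ((pick3 i (fst x) (snd x) 0, pick3 j (fst x) (snd x) 0) - ?z) (padj (Emap k k a b c p)))"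
    using ldiff_quotient[OF E lderiv_Emap E lderiv_Emap 1 2 3] by simp
  then show ?thesis
    by (simp add: conjp_def tri_def det_gmat p pm_def padj_def Emap_def matrix_mul_assoc)
qed

end

lemma br_mult: "br (c ** a) (c ** b) = det c * br a b" "br (a ** c) (b ** c) = det c * br a b"
  by (simp_all add: br_eq mat2_mult_nth det_2) (simp_all add: field_simps)

lemma br_scaleR: "br (r *\<^sub>R a) (s *\<^sub>R b) = r * s * br a b"
  by (simp add: br_eq field_simps)

lemma g0_conjp:
  assumes "det c = 1 \<or> det c = -1"
  shows "g0 (conjp c x) (conjp c y) = g0 x y"
proof -
  have "br (det c *\<^sub>R (c ** u ** adj2 c)) (det c *\<^sub>R (c ** v ** adj2 c)) = br u v" for u v
    using assms by (auto simp: br_scaleR br_mult)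
  then show ?thesis by (simp add: g0_def conjp_def)
qed

lemma linear_conjp: "linear (conjp c)"
  by (rule linearI) (simp_all add: conjp_def mat2_mult_scale_diff mat2_mult_scaleR scaleR_add_right)

lemma linear_tri: "linear (tri i j k)"
  by (rule linearI) (simp_all add: tri_def pick3_def algebra_simps)

lemma J0_conjp: "J0 (conjp c x) = conjp c (J0 x)"
  by (simp add: J0_def conjp_def mat2_mult_scale_diff mat2_mult_scaleR scaleR_diff_right mult.commute)

text \<open>The sign is that of the permutation: \<open>J0\<close> is (2 s + 1) / sqrt 3 with s =
  \<open>tri 2 0 1\<close>, and transpositions send s to its inverse -1 - s.\<close>

lemma J0_tri:
  assumes "(i, j, k) \<in> perms3"
  shows "\<exists>\<epsilon>. (\<epsilon> = 1 \<or> \<epsilon> = -1) \<and> (\<forall>x. tri i j k (J0 x) = \<epsilon> *\<^sub>R J0 (tri i j k x))"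
proof -
  define J1 where "J1 x = (fst x - 2 *\<^sub>R snd x, 2 *\<^sub>R fst x - snd x)" for x :: pt
  have J: "J0 x = (1 / sqrt 3) *\<^sub>R J1 x" for x by (simp add: J0_def J1_def)
  have "tri i j k (J1 x) = (if (i, j, k) \<in> {(0, 1, 2), (1, 2, 0), (2, 0, 1)} then 1 else -1) *\<^sub>R J1 (tri i j k x)" for x
    using assms unfolding perms3_def
    by (elim insertE emptyE) (simp_all add: tri_def pick3_def J1_def mat2_eq_iff)
  moreover have "(if (i, j, k) \<in> {(0, 1, 2), (1, 2, 0), (2, 0, 1)} then 1 else -1) \<in> {1, -1 :: real}" by simp
  ultimately obtain \<epsilon> where \<epsilon>: "\<epsilon> = 1 \<or> \<epsilon> = -1" "\<And>x. tri i j k (J1 x) = \<epsilon> *\<^sub>R J1 (tri i j k x)" by blast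
  have "tri i j k (J0 x) = \<epsilon> *\<^sub>R J0 (tri i j k x)" for x
    unfolding J linear_scale[OF linear_tri] \<epsilon>(2) by (rule scaleR_left_commute)
  with \<epsilon>(1) show ?thesis by blast
qed

lemma g0_tri:
  assumes "(i, j, k) \<in> perms3"
  shows "g0 (tri i j k x) (tri i j k y) = g0 x y"
proof -
  define B :: "mat2 \<Rightarrow> mat2 \<Rightarrow> real"
    where "B a b = a$1$2 * b$2$1 + a$2$1 * b$1$2 - a$2$2 * b$1$1 - a$1$1 * b$2$2" for a b
  have g: "6 * g0 u v = 2 * (B (fst u) (fst v) + B (snd u) (snd v)) - (B (snd u) (fst v) + B (fst u) (snd v))" for u v
    by (simp add: g0_def B_def br_eq field_simps)
  have B: "B (a - b) c = B a c - B b c" "B c (a - b) = B c a - B c b" "B (- a) c = - B a c" "B c (- a) = - B c a" "B 0 c = 0" "B c 0 = 0" for a b c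
    by (simp_all add: B_def algebra_simps)
  have "6 * g0 (tri i j k x) (tri i j k y) = 6 * g0 x y"
    using assms unfolding g perms3_def by (elim insertE emptyE) (simp_all add: tri_def pick3_def B)
  then show ?thesis by simp
qed

lemma nk_map_Kmap:
  assumes d: "d = 1 \<or> d = -1" and dets: "det a = d" "det b = d" "det c = d" and ijk: "(i, j, k) \<in> perms3"
  shows "\<exists>\<epsilon>. nk_map (Kmap i j k a b c) UNIV \<epsilon>"
proof -
  obtain \<epsilon> where \<epsilon>: "\<epsilon> = 1 \<or> \<epsilon> = -1" "\<And>x. tri i j k (J0 x) = \<epsilon> *\<^sub>R J0 (tri i j k x)" using J0_tri[OF ijk] by blast
  have "nk_map (Kmap i j k a b c) UNIV \<epsilon>"
  proof
    fix p x y assume p: "p \<in> NN"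
    show "Kmap i j k a b c p \<in> NN" by (rule Kmap_in_NN[OF d dets p])
    have dk: "det (gmat k a b c p) = 1 \<or> det (gmat k a b c p) = -1" using det_gmat[OF d dets p] d by simp
    show "ldiff (Kmap i j k a b c) (J0 x) p = \<epsilon> *\<^sub>R J0 (ldiff (Kmap i j k a b c) x p)" if "x \<in> trless"
      using that p by (simp add: ldiff_Kmap[OF d dets] trless_closed \<epsilon>(2) J0_conjp linear_scale[OF linear_conjp])
    show "g0 (ldiff (Kmap i j k a b c) x p) (ldiff (Kmap i j k a b c) y p) = g0 x y" if "x \<in> trless" "y \<in> trless"
      using that p by (simp add: ldiff_Kmap[OF d dets] g0_conjp[OF dk] g0_tri[OF ijk])
  qed (use \<epsilon>(1) diff_times_Kmap in auto)
  then show ?thesis by blast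
qed

section \<open>Inverses of the model maps and their match with the six listed maps\<close>

lemma matrix_inv_simps:
  fixes m n :: mat2
  shows "det m \<noteq> 0 \<Longrightarrow> matrix_inv m ** m = mat 1" "det m \<noteq> 0 \<Longrightarrow> m ** matrix_inv m = mat 1"
    "det m \<noteq> 0 \<Longrightarrow> matrix_inv m ** (m ** x) = x" "det m \<noteq> 0 \<Longrightarrow> m ** (matrix_inv m ** x) = x"
    "det m \<noteq> 0 \<Longrightarrow> matrix_inv (matrix_inv m) = m"
    "det m \<noteq> 0 \<Longrightarrow> det n \<noteq> 0 \<Longrightarrow> matrix_inv (m ** n) = matrix_inv n ** matrix_inv m"
    "det m \<noteq> 0 \<Longrightarrow> det (matrix_inv m) = 1 / det m"
    "matrix_inv (mat 1 :: mat2) = mat 1"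
proof -
  show 1: "matrix_inv m ** m = mat 1" "m ** matrix_inv m = mat 1" if "det m \<noteq> 0" for m :: mat2
    using that by (simp_all add: matrix_inv_eq_adj2 mat2_mult_scaleR mult_adj2 mat_eq_scaleR[of "det m"])
  show "det m \<noteq> 0 \<Longrightarrow> matrix_inv m ** (m ** x) = x" "det m \<noteq> 0 \<Longrightarrow> m ** (matrix_inv m ** x) = x"
    by (simp_all add: matrix_mul_assoc 1)
  show 2: "det (matrix_inv m) = 1 / det m" if "det m \<noteq> 0" for m :: mat2
    using 1(1)[OF that] det_mul[of "matrix_inv m" m] that by (simp add: field_simps)
  have uniq: "matrix_inv u = v" if "det u \<noteq> 0" "u ** v = mat 1" for u v :: mat2
    using 1(1)[OF that(1)] that(2) by (metis matrix_mul_assoc matrix_mul_lid matrix_mul_rid)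
  show "matrix_inv (matrix_inv m) = m" if "det m \<noteq> 0"
    using that by (intro uniq) (simp_all add: 1 2)
  show "matrix_inv (m ** n) = matrix_inv n ** matrix_inv m" if "det m \<noteq> 0" "det n \<noteq> 0"
    using that
    by (intro uniq) (simp_all add: det_mul, metis 1(2) matrix_mul_assoc matrix_mul_lid)
  show "matrix_inv (mat 1 :: mat2) = mat 1" by (intro uniq) simp_all
qed

definition inv3 :: "nat \<times> nat \<times> nat \<Rightarrow> nat \<times> nat \<times> nat" where
  "inv3 t = (if t = (1, 2, 0) then (2, 0, 1) else if t = (2, 0, 1) then (1, 2, 0) else t)"

text \<open>On lifts the map multiplies by (a, b, c) and then permutes. The inverse undoes the
  permutation and multiplies by inverses, so the inverses appear in the permuted order i, j,
  k.\<close>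

lemma Kmap_inverse:
  assumes d: "d = 1 \<or> d = -1" and dets: "det a = d" "det b = d" "det c = d" and ijk: "(i, j, k) \<in> perms3"
  shows "\<exists>i' j' k' a' b' c'. (i', j', k') \<in> perms3 \<and> det a' = d \<and> det b' = d \<and> det c' = d \<and>
    (\<forall>p\<in>NN. Kmap i' j' k' a' b' c' (Kmap i j k a b c p) = p) \<and>
    (\<forall>p\<in>NN. Kmap i j k a b c (Kmap i' j' k' a' b' c' p) = p)"
proof -
  define e where "e m = matrix_inv (pick3 m a b c)" for m
  have d0: "d \<noteq> 0" "1 / d = d" using d by auto
  have de: "det (e m) = d" for m using d0 by (simp add: e_def pick3_def matrix_inv_simps(7) dets)
  obtain i' j' k' where t: "(i', j', k') = inv3 (i, j, k)" by (metis prod_cases3)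
  have "(i', j', k') \<in> perms3" using ijk t by (auto simp: perms3_def inv3_def)
  moreover have "Kmap i' j' k' (e i) (e j) (e k) (Kmap i j k a b c p) = p" if p: "p \<in> NN" for p
    unfolding Kmap_eq[OF d de de de Kmap_in_NN[OF d dets p]] unfolding Kmap_eq[OF d dets p]
    using ijk t p d0 unfolding perms3_def
    by (cases p; elim insertE emptyE) (simp_all add: inv3_def gmat_def pick3_def e_def matrix_inv_simps dets det_mul NN_iff
        flip: matrix_mul_assoc)
  moreover have "Kmap i j k a b c (Kmap i' j' k' (e i) (e j) (e k) p) = p" if p: "p \<in> NN" for p
    unfolding Kmap_eq[OF d dets Kmap_in_NN[OF d de de de p]] unfolding Kmap_eq[OF d de de de p]
    using ijk t p d0 unfolding perms3_def
    by (cases p; elim insertE emptyE) (simp_all add: inv3_def gmat_def pick3_def e_def matrix_inv_simps dets det_mul NN_iff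
        flip: matrix_mul_assoc)
  ultimately show ?thesis using de by blast
qed

text \<open>Each listed map permutes the entries of the lift (p, q, 1) and divides on the right by
  the new third entry.\<close>

lemma Psi_set_Kmap:
  assumes d: "d = 1 \<or> d = -1" and dets: "det a = d" "det b = d" "det c = d"
  shows "\<Psi> \<in> Psi_set \<Longrightarrow> \<exists>i j k. (i, j, k) \<in> perms3 \<and> (\<forall>p\<in>NN. \<Psi> (phi a b c p) = Kmap i j k a b c p)"
    "(i, j, k) \<in> perms3 \<Longrightarrow> \<exists>\<Psi>\<in>Psi_set. \<forall>p\<in>NN. \<Psi> (phi a b c p) = Kmap i j k a b c p"
proof -
  have d0: "d \<noteq> 0" using d by auto
  let ?R = "\<lambda>(\<Psi>::pt \<Rightarrow> pt) (i, j, k). \<forall>p\<in>NN. \<Psi> (phi a b c p) = Kmap i j k a b c p"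
  have R: "?R (\<lambda>(p, q). (p, q)) (0, 1, 2)" "?R (\<lambda>(p, q). (q, p)) (1, 0, 2)"
    "?R (\<lambda>(p, q). (p ** matrix_inv q, matrix_inv q)) (0, 2, 1)"
    "?R (\<lambda>(p, q). (matrix_inv q, p ** matrix_inv q)) (2, 0, 1)"
    "?R (\<lambda>(p, q). (q ** matrix_inv p, matrix_inv p)) (1, 2, 0)"
    "?R (\<lambda>(p, q). (matrix_inv p, q ** matrix_inv p)) (2, 1, 0)"
    using d0 by (auto simp: Kmap_eq[OF d dets] phi_def gmat_def pick3_def matrix_inv_simps dets det_mul NN_iff
        simp flip: matrix_mul_assoc)
  show "\<Psi> \<in> Psi_set \<Longrightarrow> \<exists>i j k. (i, j, k) \<in> perms3 \<and> (\<forall>p\<in>NN. \<Psi> (phi a b c p) = Kmap i j k a b c p)"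
    unfolding Psi_set_def perms3_def using R by (elim insertE emptyE) blast+
  show "(i, j, k) \<in> perms3 \<Longrightarrow> \<exists>\<Psi>\<in>Psi_set. \<forall>p\<in>NN. \<Psi> (phi a b c p) = Kmap i j k a b c p"
    unfolding Psi_set_def perms3_def using R by (elim insertE emptyE) blast+
qed

section \<open>Passage between \<open>isometry_NK\<close> and the trivialised conditions\<close>

lemma gN_eq: "p \<in> NN \<Longrightarrow> gN p v w = g0 (pm (padj p) v) (pm (padj p) w)"
  by (simp add: gN_def g0_def pm_def padj_def Let_def NN_iff matrix_inv_eq_adj2)

lemma JN_eq: "p \<in> NN \<Longrightarrow> JN p v = pm p (J0 (pm (padj p) v))"
  by (simp add: JN_def J0_def pm_def padj_def Let_def NN_iff matrix_inv_eq_adj2 mat2_mult_scaleR)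

lemma tangent_eq: "tangent p = pm p ` trless"
  by (force simp: tangent_def pm_def trless_def image_iff)

lemma frechet_pm: "frechet_derivative G (at p) (pm p x) = lderiv x G p"
  by (simp add: lderiv_def dirderiv_def)

lemma metric_complex_trivialised:
  assumes p: "p \<in> NN" and G: "G p \<in> NN"
  shows "(\<forall>v\<in>tangent p. \<forall>w\<in>tangent p. gN (G p) (frechet_derivative G (at p) v) (frechet_derivative G (at p) w) = gN p v w)
      \<longleftrightarrow> (\<forall>x\<in>trless. \<forall>y\<in>trless. g0 (ldiff G x p) (ldiff G y p) = g0 x y)"
    and "(\<forall>v\<in>tangent p. frechet_derivative G (at p) (JN p v) = \<epsilon> *\<^sub>R JN (G p) (frechet_derivative G (at p) v))
      \<longleftrightarrow> (\<forall>x\<in>trless. ldiff G (J0 x) p = \<epsilon> *\<^sub>R J0 (ldiff G x p))"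
proof -
  show "(\<forall>v\<in>tangent p. \<forall>w\<in>tangent p. gN (G p) (frechet_derivative G (at p) v) (frechet_derivative G (at p) w) = gN p v w)
      \<longleftrightarrow> (\<forall>x\<in>trless. \<forall>y\<in>trless. g0 (ldiff G x p) (ldiff G y p) = g0 x y)"
    by (simp add: tangent_eq gN_eq[OF p] gN_eq[OF G] frechet_pm pm_padj_left[OF p] flip: ldiff_def)
  have "lderiv (J0 x) G p = \<epsilon> *\<^sub>R pm (G p) (J0 (ldiff G x p)) \<longleftrightarrow> ldiff G (J0 x) p = \<epsilon> *\<^sub>R J0 (ldiff G x p)" for x
    unfolding ldiff_def by (metis pm.scaleR_right pm_padj_left[OF G])
  then show "(\<forall>v\<in>tangent p. frechet_derivative G (at p) (JN p v) = \<epsilon> *\<^sub>R JN (G p) (frechet_derivative G (at p) v))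
      \<longleftrightarrow> (\<forall>x\<in>trless. ldiff G (J0 x) p = \<epsilon> *\<^sub>R J0 (ldiff G x p))"
    by (simp add: tangent_eq JN_eq[OF p] JN_eq[OF G] frechet_pm pm_padj_left[OF p] flip: ldiff_def)
qed

lemma isometry_NK_imp_nk_map:
  assumes "isometry_NK F"
  shows "\<exists>G U \<epsilon>. nk_map G U \<epsilon> \<and> (\<forall>p\<in>NN. G p = F p)"
proof -
  have FN: "F p \<in> NN" if "p \<in> NN" for p using assms that unfolding isometry_NK_def by blast
  from assms obtain G \<epsilon> where se: "smooth_ext NN F G"
    and g: "\<forall>p\<in>NN. \<forall>v\<in>tangent p. \<forall>w\<in>tangent p.
            gN (F p) (frechet_derivative G (at p) v) (frechet_derivative G (at p) w) = gN p v w"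
    and \<epsilon>: "\<epsilon> = 1 \<or> \<epsilon> = -1"
    and J: "\<forall>p\<in>NN. \<forall>v\<in>tangent p.
               frechet_derivative G (at p) (JN p v) = \<epsilon> *\<^sub>R JN (F p) (frechet_derivative G (at p) v)"
    unfolding isometry_NK_def by blast
  from se obtain U where U: "smooth_on U G" "NN \<subseteq> U" and GF: "\<And>p. p \<in> NN \<Longrightarrow> G p = F p"
    unfolding smooth_ext_def by blast
  have "nk_map G U \<epsilon>"
  proof
    show "open U" using U(1) by (simp add: smooth_on_def)
    fix p x y assume p: "p \<in> NN"
    show Gp: "G p \<in> NN" using GF FN p by simp
    show "x \<in> trless \<Longrightarrow> y \<in> trless \<Longrightarrow> g0 (ldiff G x p) (ldiff G y p) = g0 x y"
      using metric_complex_trivialised(1)[of p G, OF p Gp] g p unfolding GF[OF p] by blast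
    show "x \<in> trless \<Longrightarrow> ldiff G (J0 x) p = \<epsilon> *\<^sub>R J0 (ldiff G x p)"
      using metric_complex_trivialised(2)[of p G \<epsilon>, OF p Gp] J p unfolding GF[OF p] by blast
  qed (use U smooth_on_imp_diff_times \<epsilon> in auto)
  then show ?thesis using GF by blast
qed

lemma nk_map_imp_Kmap:
  assumes "nk_map G U \<epsilon>"
  shows "\<exists>a b c d i j k. (d = 1 \<or> d = -1) \<and> det a = d \<and> det b = d \<and> det c = d \<and> (i, j, k) \<in> perms3 \<and>
    (\<forall>p\<in>NN. G p = Kmap i j k a b c p)"
proof -
  interpret nk_map G U \<epsilon> by (rule assms)
  note one = pone_in_NN
  have oneU: "pone \<in> U" using one NN_U by auto
  note surj = linear_trless_surj[OF linear_L[OF oneU] L_trless[OF one] metric[OF one]]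
  have inj: "x = 0" if "x \<in> trless" "L x pone = 0" for x
    using inj_onD[OF surj(1), of x 0] that linear_0[OF linear_L[OF oneU]] subspace_0[OF subspace_trless] by simp
  obtain C i j k where C: "det C = 1 \<or> det C = -1" and ijk: "(i, j, k) \<in> perms3"
    and LC: "\<And>x. x \<in> trless \<Longrightarrow> L x pone = conjp C (tri i j k x)"
    using linear_isometry_classification[OF linear_L[OF oneU] L_trless[OF one] inj surj(2) tor_L[OF one] curvature[OF one]]
    by blast
  define P where "P = G pone"
  have P: "det (fst P) = 1" "det (snd P) = 1" using G_NN[OF one] by (simp_all add: P_def NN_iff)
  define d where "d = det C"
  have d: "d = 1 \<or> d = -1" using C by (simp add: d_def)
  then have d0: "d \<noteq> 0" by auto
  \<comment> \<open>The permuted triple is forced to be (P1 C, P2 C, C): its quotients by the third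
    entry give the value P at the base point, and the third entry C gives the conjugation in the
    differential.\<close>
  have "\<exists>a b c. pick3 i a b c = fst P ** C \<and> pick3 j a b c = snd P ** C \<and> pick3 k a b c = C \<and>
      det a = d \<and> det b = d \<and> det c = d"
    using ijk P unfolding perms3_def d_def
    by (elim insertE emptyE) (auto simp: pick3_def det_mul)
  then obtain a b c where abc: "pick3 i a b c = fst P ** C" "pick3 j a b c = snd P ** C" "pick3 k a b c = C"
    and dets: "det a = d" "det b = d" "det c = d" by blast
  have g1: "gmat m a b c pone = pick3 m a b c" for m by (simp add: gmat_def pone_def)
  obtain \<delta> where K: "nk_map (Kmap i j k a b c) UNIV \<delta>" using nk_map_Kmap[OF d dets ijk] by blast
  have "Kmap i j k a b c pone = P"
    unfolding Kmap_eq[OF d dets one] g1 abc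
    using d0 by (simp add: matrix_inv_simps pt_eq_iff flip: matrix_mul_assoc d_def)
  moreover have "ldiff (Kmap i j k a b c) x pone = L x pone" if "x \<in> trless" for x
    unfolding ldiff_Kmap[OF d dets one that] g1 abc LC[OF that] ..
  ultimately have "G p = Kmap i j k a b c p" if "p \<in> NN" for p
    using nk_map_unique[OF assms K _ _ that] P_def by simp
  then show ?thesis using d dets ijk by blast
qed

text \<open>Only the values of F on N matter: one polynomial \<open>Kmap\<close> extends F, another
  extends its inverse.\<close>

lemma Kmap_isometry:
  assumes d: "d = 1 \<or> d = -1" and dets: "det a = d" "det b = d" "det c = d" and ijk: "(i, j, k) \<in> perms3"
    and F: "\<And>p. p \<in> NN \<Longrightarrow> F p = Kmap i j k a b c p"
  shows "isometry_NK F"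
proof -
  let ?K = "Kmap i j k a b c"
  obtain \<epsilon> where K: "nk_map ?K UNIV \<epsilon>" using nk_map_Kmap[OF d dets ijk] by blast
  interpret nk_map ?K UNIV \<epsilon> by (rule K)
  obtain i' j' k' a' b' c' where ijk': "(i', j', k') \<in> perms3" and dets': "det a' = d" "det b' = d" "det c' = d"
    and inv: "\<And>p. p \<in> NN \<Longrightarrow> Kmap i' j' k' a' b' c' (?K p) = p" "\<And>p. p \<in> NN \<Longrightarrow> ?K (Kmap i' j' k' a' b' c' p) = p"
    using Kmap_inverse[OF d dets ijk] by blast
  let ?H = "Kmap i' j' k' a' b' c'"
  have H: "?H p \<in> NN" if "p \<in> NN" for p by (rule Kmap_in_NN[OF d dets' that])
  have inj: "inj_on F NN"
    by (rule inj_on_inverseI[of _ ?H]) (simp add: F inv(1))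
  have img: "F ` NN = NN"
  proof
    show "F ` NN \<subseteq> NN" using F G_NN by auto
    show "NN \<subseteq> F ` NN"
    proof
      fix p assume p: "p \<in> NN"
      then have "p = F (?H p)" using F[OF H[OF p]] inv(2)[OF p] by simp
      then show "p \<in> F ` NN" using H[OF p] by (rule image_eqI)
    qed
  qed
  have smooth: "smooth_on UNIV (Kmap i j k a b c)" for i j k a b c
    by (intro smooth_onI open_UNIV diff_times_Kmap)
  have "?H p = inv_into NN F p" if "p \<in> NN" for p
    using inv_into_f_eq[OF inj H[OF that]] F[OF H[OF that]] inv(2)[OF that] by simp
  then have 1: "smooth_ext NN (inv_into NN F) ?H"
    unfolding smooth_ext_def using smooth[of i' j' k' a' b' c'] by blast
  have 2: "smooth_ext NN F ?K" unfolding smooth_ext_def using smooth[of i j k a b c] F[symmetric] by blast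
  have 3: "gN (F p) (frechet_derivative ?K (at p) v) (frechet_derivative ?K (at p) w) = gN p v w"
    if p: "p \<in> NN" and "v \<in> tangent p" "w \<in> tangent p" for p v w
    using metric_complex_trivialised(1)[of p ?K, OF p G_NN[OF p]] metric[OF p] that unfolding F[OF p] by blast
  have 4: "frechet_derivative ?K (at p) (JN p v) = \<epsilon> *\<^sub>R JN (F p) (frechet_derivative ?K (at p) v)"
    if p: "p \<in> NN" and "v \<in> tangent p" for p v
    using metric_complex_trivialised(2)[of p ?K \<epsilon>, OF p G_NN[OF p]] complex[OF p] that unfolding F[OF p] by blast
  show ?thesis unfolding isometry_NK_def
  proof (intro conjI)
    show "F ` NN = NN" by (rule img)
    show "inj_on F NN" by (rule inj)
    show "\<exists>H. smooth_ext NN (inv_into NN F) H" by (rule exI, rule 1)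
    show "\<exists>G. smooth_ext NN F G \<and>
        (\<forall>p\<in>NN. \<forall>v\<in>tangent p. \<forall>w\<in>tangent p.
            gN (F p) (frechet_derivative G (at p) v) (frechet_derivative G (at p) w) = gN p v w) \<and>
        (\<exists>\<epsilon>::real. (\<epsilon> = 1 \<or> \<epsilon> = -1) \<and>
            (\<forall>p\<in>NN. \<forall>v\<in>tangent p.
               frechet_derivative G (at p) (JN p v) = \<epsilon> *\<^sub>R JN (F p) (frechet_derivative G (at p) v)))"
      by (intro exI[of _ ?K] conjI 2 exI[of _ \<epsilon>] sign ballI 3 4)
  qed
qed

theorem theorem1:
  fixes F :: "pt \<Rightarrow> pt"
  shows "isometry_NK F \<longleftrightarrow>
    (\<exists>a b c \<Psi>. (det a = 1 \<or> det a = -1) \<and> det b = det a \<and> det c = det a \<and>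
        \<Psi> \<in> Psi_set \<and> (\<forall>x\<in>NN. F x = \<Psi> (phi a b c x)))"
proof
  assume "isometry_NK F"
  from isometry_NK_imp_nk_map[OF this] obtain G U \<epsilon>
    where nk: "nk_map G U \<epsilon>" and GF: "\<forall>p\<in>NN. G p = F p" by (elim exE conjE)
  from nk_map_imp_Kmap[OF nk] obtain a b c d i j k where d: "d = 1 \<or> d = -1"
    and dets: "det a = d" "det b = d" "det c = d"
    and ijk: "(i, j, k) \<in> perms3" and G: "\<forall>p\<in>NN. G p = Kmap i j k a b c p"
    by (elim exE conjE)
  from Psi_set_Kmap(2)[OF d dets ijk] obtain \<Psi> where \<Psi>: "\<Psi> \<in> Psi_set" "\<forall>p\<in>NN. \<Psi> (phi a b c p) = Kmap i j k a b c p"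
    by blast
  have F: "\<forall>x\<in>NN. F x = \<Psi> (phi a b c x)" by (metis GF G \<Psi>(2))
  have "(det a = 1 \<or> det a = -1) \<and> det b = det a \<and> det c = det a" using d dets by simp
  with F \<Psi>(1) show "\<exists>a b c \<Psi>. (det a = 1 \<or> det a = -1) \<and> det b = det a \<and> det c = det a \<and>
        \<Psi> \<in> Psi_set \<and> (\<forall>x\<in>NN. F x = \<Psi> (phi a b c x))"
    by blast
next
  assume "\<exists>a b c \<Psi>. (det a = 1 \<or> det a = -1) \<and> det b = det a \<and> det c = det a \<and>
        \<Psi> \<in> Psi_set \<and> (\<forall>x\<in>NN. F x = \<Psi> (phi a b c x))"
  \<comment> \<open>The trivial \<open>det a = det a\<close> makes the list match the premises of
    \<open>Psi_set_Kmap\<close> with d = det a.\<close>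
  then obtain a b c \<Psi> where *: "det a = 1 \<or> det a = -1" "det a = det a" "det b = det a" "det c = det a"
    and \<Psi>: "\<Psi> \<in> Psi_set" and F: "\<forall>x\<in>NN. F x = \<Psi> (phi a b c x)" by blast
  from Psi_set_Kmap(1)[OF * \<Psi>] obtain i j k
    where ijk: "(i, j, k) \<in> perms3" and K: "\<forall>p\<in>NN. \<Psi> (phi a b c p) = Kmap i j k a b c p"
    by blast
  have "F p = Kmap i j k a b c p" if "p \<in> NN" for p using F[rule_format, OF that] K[rule_format, OF that] by (rule trans)
  then show "isometry_NK F" by (rule Kmap_isometry[OF * ijk])
qed

end
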